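(* Let $\mathcal{T}=SO_0(1,2n)/U(n)$ be the twistor space over the $2n$-dimensional hyperbolic space $H_{2n}$, endowed with its Kirillov–Kostant–Souriau symplectic form $\omega$, and let $J^{+}$ and $J^-$ be its two natural almost complex structures. Then $J^+$ is compatible with $\omega$ and integrable, but not positive; and $J^-$ is positive, compatible with $\omega$, and maximally non integrable.
   Context: General notions. An almost complex structure $J$ (a smooth field of endomorphisms of the tangent bundle with $J^2=-\mathrm{Id}$) on a symplectic manifold $(M,\omega)$ is compatible with $\omega$ if $g_J(X,Y):=\omega(X,JY)$ is symmetric, and positive if moreover $g_J$ is positive definite. Its Nijenhuis tensor is $N^J(X,Y)=[JX,JY]-J[JX,Y]-J[X,JY]-[X,Y]$; $J$ is integrable if and only if $N^J=0$, and $J$ is called maximally non integrable if at every point $x$ the values $N^J_x(X,Y)$, $X,Y\in T_xM$, span $T_xM$. The twistor space. Let $\mathbb{R}^{1,2n}=\mathbb{R}e_0\oplus\mathbb{R}^{2n}$ with the Lorentzian scalar product $-x^0y^0+\sum_{i=1}^{2n}x^iy^i$, and let $H_{2n}=\{x\in\mathbb{R}^{1,2n}\mid -(x^0)^2+\sum_{i=1}^{2n}(x^i)^2=-1,\ x^0>0\}=SO_0(1,2n)/SO(2n)$, with the induced Riemannian metric, where $SO(2n)$ is embedded as the matrices $\begin{pmatrix} 1 & 0 \\ 0 & B \end{pmatrix}$. The twistor space $\mathcal{T}$ fibers over $H_{2n}$, the fiber over $x$ consisting of the complex structures on $T_xH_{2n}$ which are compatible with the metric and the orientation, i.e. which are given,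 in some oriented orthonormal basis, by $j_0=\begin{pmatrix} 0 & -I_n \\ I_n & 0 \end{pmatrix}$. The group $SO_0(1,2n)$ acts transitively on $\mathcal{T}$ (by $A\cdot j=A\circ j\circ A^{-1}$, over the point $Ax$), and $\mathcal{T}=SO_0(1,2n)/U(n)$ with $U(n)=\{C\in SO(2n)\mid Cj_0=j_0C\}$, the stabilizer of the base point $t_0$ given by $j_0$ on $T_{e_0}H_{2n}=\mathbb{R}^{2n}$. Let $\pi_1:SO_0(1,2n)\to\mathcal{T}$ be the natural projection. Its differential at the identity, $\pi_{1*}$, restricts to a linear isomorphism from $$\left\{\begin{pmatrix} 0 & {}^tu \\ u & B \end{pmatrix}\in\mathfrak{so}(1,2n)\ \Big|\ u\in\mathbb{R}^{2n},\ B\in\mathfrak{so}(2n),\ Bj_0=-j_0B\right\}$$ onto $T_{t_0}\mathcal{T}$. Symplectic form. $\mathcal{T}$ is identified with the adjoint orbit of $j_0'=\begin{pmatrix} 0 & 0 \\ 0 & j_0 \end{pmatrix}\in\mathfrak{so}(1,2n)$, and $\omega$ is the $SO_0(1,2n)$-invariant symplectic form given at $t_0$ by $\omega_{t_0}(\pi_{1*}A,\pi_{1*}A')=-\operatorname{Tr}\big(j_0'[A,A']\big)$. Almost complex structures. $J^{\pm}$ are the $SO_0(1,2n)$-invariant almost complex structures on $\mathcal{T}$ given at $t_0$, for $u\in\mathbb{R}^{2n}$ and $B\in\mathfrak{so}(2n)$ with $Bj_0=-j_0B$, by $$J^{\pm}_{t_0}\left(\pi_{1*}\begin{pmatrix}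 0 & {}^tu \\ u & B \end{pmatrix}\right)=\pi_{1*}\begin{pmatrix} 0 & \pm{}^t(j_0u) \\ \pm j_0u & j_0B \end{pmatrix}.$$
   Formalization: Maximal non-integrability of J^- is claimed only for n ≥ 2: for n = 1 the twistor space is the hyperbolic plane itself, a real surface on which every Nijenhuis tensor vanishes, so that claim fails; all other claims are for every n ≥ 1. *)

theory Defs
  imports "HOL-Analysis.Analysis"
begin

section \<open>Smooth maps and calculus on embedded submanifolds\<close>

primrec Ck_on :: "nat \<Rightarrow> 'a::real_normed_vector set \<Rightarrow> ('a \<Rightarrow> 'b::real_normed_vector) \<Rightarrow> bool" where
  "Ck_on 0 U f \<longleftrightarrow> continuous_on U f"
| "Ck_on (Suc k) U f \<longleftrightarrow>
     (\<forall>x\<in>U. f differentiable (at x)) \<and> (\<forall>v. Ck_on k U (\<lambda>x. frechet_derivative f (at x) v))"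

text \<open>To be used for open sets \<open>U\<close> only.\<close>

definition smooth_on :: "'a::real_normed_vector set \<Rightarrow> ('a \<Rightarrow> 'b::real_normed_vector) \<Rightarrow> bool" where
  "smooth_on U f \<longleftrightarrow> (\<forall>k. Ck_on k U f)"

text \<open>A map on an arbitrary subset of a Euclidean space is smooth if it locally extends to a smooth
  map on an open subset of the ambient space. On an embedded submanifold this is smoothness in charts.\<close>

definition smooth_map_on :: "'a::real_normed_vector set \<Rightarrow> ('a \<Rightarrow> 'b::real_normed_vector) \<Rightarrow> bool" where
  "smooth_map_on S f \<longleftrightarrow>
     (\<forall>p\<in>S. \<exists>U g. open U \<and> p \<in> U \<and> smooth_on U g \<and> (\<forall>q\<in>S \<inter> U. g q = f q))"

text \<open>In the rest of this section \<open>M\<close> stands for an embedded submanifold of the Euclidean space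
  \<open>'a\<close>, and tangent vectors to \<open>M\<close> are regarded as elements of \<open>'a\<close>.\<close>

definition curve_through :: "'a::euclidean_space set \<Rightarrow> 'a \<Rightarrow> 'a \<Rightarrow> (real \<Rightarrow> 'a) \<Rightarrow> bool" where
  "curve_through M p v \<gamma> \<longleftrightarrow>
     (\<exists>\<epsilon>>0. smooth_on {-\<epsilon><..<\<epsilon>} \<gamma> \<and> \<gamma> ` {-\<epsilon><..<\<epsilon>} \<subseteq> M) \<and>
     \<gamma> 0 = p \<and> (\<gamma> has_vector_derivative v) (at 0)"

definition tangent_space :: "'a::euclidean_space set \<Rightarrow> 'a \<Rightarrow> 'a set" where
  "tangent_space M p = {v. \<exists>\<gamma>. curve_through M p v \<gamma>}"

text \<open>The differential at \<open>p\<close> of a map \<open>f\<close> defined on \<open>M\<close>, evaluated at a tangent vector \<open>v\<close>.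
  The ambient derivatives (even those relative to \<open>M\<close>) are not determined by \<open>f\<close> on \<open>M\<close>, hence the
  use of curves. For smooth \<open>f\<close> the chain rule makes the description unique.\<close>

definition differential ::
  "'a::euclidean_space set \<Rightarrow> ('a \<Rightarrow> 'b::euclidean_space) \<Rightarrow> 'a \<Rightarrow> 'a \<Rightarrow> 'b" where
  "differential M f p v =
     (THE w. \<exists>\<gamma>. curve_through M p v \<gamma> \<and> ((f \<circ> \<gamma>) has_vector_derivative w) (at 0))"

definition vector_field :: "'a::euclidean_space set \<Rightarrow> ('a \<Rightarrow> 'a) \<Rightarrow> bool" where
  "vector_field M X \<longleftrightarrow> smooth_map_on M X \<and> (\<forall>p\<in>M. X p \<in> tangent_space M p)"

text \<open>In ambient coordinates, the usual bracket \<open>[X,Y]f = X(Yf) - Y(Xf)\<close> is \<open>D\<^sub>X Y - D\<^sub>Y X\<close>.\<close>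

definition lie_bracket ::
  "'a::euclidean_space set \<Rightarrow> ('a \<Rightarrow> 'a) \<Rightarrow> ('a \<Rightarrow> 'a) \<Rightarrow> 'a \<Rightarrow> 'a" where
  "lie_bracket M X Y p = differential M Y p (X p) - differential M X p (Y p)"


section \<open>Symplectic forms and almost complex structures\<close>

text \<open>A 2-form \<open>\<omega>\<close> takes a point and two tangent vectors, a field of endomorphisms \<open>J\<close> takes a point
  and a tangent vector. Only their values on the tangent spaces of \<open>M\<close> matter.\<close>

definition exterior_deriv2 ::
  "'a::euclidean_space set \<Rightarrow> ('a \<Rightarrow> 'a \<Rightarrow> 'a \<Rightarrow> real) \<Rightarrow>
     ('a \<Rightarrow> 'a) \<Rightarrow> ('a \<Rightarrow> 'a) \<Rightarrow> ('a \<Rightarrow> 'a) \<Rightarrow> 'a \<Rightarrow> real" where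
  "exterior_deriv2 M \<omega> X Y Z p =
       differential M (\<lambda>q. \<omega> q (Y q) (Z q)) p (X p)
     + differential M (\<lambda>q. \<omega> q (Z q) (X q)) p (Y p)
     + differential M (\<lambda>q. \<omega> q (X q) (Y q)) p (Z p)
     - \<omega> p (lie_bracket M X Y p) (Z p)
     - \<omega> p (lie_bracket M Y Z p) (X p)
     - \<omega> p (lie_bracket M Z X p) (Y p)"

definition symplectic_form :: "'a::euclidean_space set \<Rightarrow> ('a \<Rightarrow> 'a \<Rightarrow> 'a \<Rightarrow> real) \<Rightarrow> bool" where
  "symplectic_form M \<omega> \<longleftrightarrow>
     smooth_map_on {(p, v, w). p \<in> M \<and> v \<in> tangent_space M p \<and> w \<in> tangent_space M p}
       (\<lambda>(p, v, w). \<omega> p v w) \<and>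
     (\<forall>p\<in>M. \<forall>u\<in>tangent_space M p. \<forall>v\<in>tangent_space M p. \<forall>w\<in>tangent_space M p. \<forall>a b.
        \<omega> p (a *\<^sub>R u + b *\<^sub>R v) w = a * \<omega> p u w + b * \<omega> p v w) \<and>
     (\<forall>p\<in>M. \<forall>v\<in>tangent_space M p. \<forall>w\<in>tangent_space M p. \<omega> p v w = - \<omega> p w v) \<and>
     (\<forall>p\<in>M. \<forall>v\<in>tangent_space M p. (\<forall>w\<in>tangent_space M p. \<omega> p v w = 0) \<longrightarrow> v = 0) \<and>
     (\<forall>X Y Z. vector_field M X \<longrightarrow> vector_field M Y \<longrightarrow> vector_field M Z \<longrightarrow>
        (\<forall>p\<in>M. exterior_deriv2 M \<omega> X Y Z p = 0))"

definition almost_complex_structure :: "'a::euclidean_space set \<Rightarrow> ('a \<Rightarrow> 'a \<Rightarrow> 'a) \<Rightarrow> bool" where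
  "almost_complex_structure M J \<longleftrightarrow>
     smooth_map_on {(p, v). p \<in> M \<and> v \<in> tangent_space M p} (\<lambda>(p, v). J p v) \<and>
     (\<forall>p\<in>M. \<forall>v\<in>tangent_space M p. J p v \<in> tangent_space M p) \<and>
     (\<forall>p\<in>M. \<forall>v\<in>tangent_space M p. \<forall>w\<in>tangent_space M p. \<forall>a b.
        J p (a *\<^sub>R v + b *\<^sub>R w) = a *\<^sub>R J p v + b *\<^sub>R J p w) \<and>
     (\<forall>p\<in>M. \<forall>v\<in>tangent_space M p. J p (J p v) = - v)"

definition assoc_form ::
  "('a \<Rightarrow> 'a \<Rightarrow> 'a \<Rightarrow> real) \<Rightarrow> ('a \<Rightarrow> 'a \<Rightarrow> 'a) \<Rightarrow> 'a \<Rightarrow> 'a \<Rightarrow> 'a \<Rightarrow> real" where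
  "assoc_form \<omega> J p v w = \<omega> p v (J p w)"

definition compatible_acs ::
  "'a::euclidean_space set \<Rightarrow> ('a \<Rightarrow> 'a \<Rightarrow> 'a \<Rightarrow> real) \<Rightarrow> ('a \<Rightarrow> 'a \<Rightarrow> 'a) \<Rightarrow> bool" where
  "compatible_acs M \<omega> J \<longleftrightarrow>
     symplectic_form M \<omega> \<and> almost_complex_structure M J \<and>
     (\<forall>p\<in>M. \<forall>v\<in>tangent_space M p. \<forall>w\<in>tangent_space M p.
        assoc_form \<omega> J p v w = assoc_form \<omega> J p w v)"

definition positive_acs ::
  "'a::euclidean_space set \<Rightarrow> ('a \<Rightarrow> 'a \<Rightarrow> 'a \<Rightarrow> real) \<Rightarrow> ('a \<Rightarrow> 'a \<Rightarrow> 'a) \<Rightarrow> bool" where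
  "positive_acs M \<omega> J \<longleftrightarrow>
     compatible_acs M \<omega> J \<and>
     (\<forall>p\<in>M. \<forall>v\<in>tangent_space M p. v \<noteq> 0 \<longrightarrow> assoc_form \<omega> J p v v > 0)"

definition nijenhuis ::
  "'a::euclidean_space set \<Rightarrow> ('a \<Rightarrow> 'a \<Rightarrow> 'a) \<Rightarrow> ('a \<Rightarrow> 'a) \<Rightarrow> ('a \<Rightarrow> 'a) \<Rightarrow> 'a \<Rightarrow> 'a" where
  "nijenhuis M J X Y p =
     lie_bracket M (\<lambda>q. J q (X q)) (\<lambda>q. J q (Y q)) p
     - J p (lie_bracket M (\<lambda>q. J q (X q)) Y p)
     - J p (lie_bracket M X (\<lambda>q. J q (Y q)) p)
     - lie_bracket M X Y p"

definition integrable_acs :: "'a::euclidean_space set \<Rightarrow> ('a \<Rightarrow> 'a \<Rightarrow> 'a) \<Rightarrow> bool" where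
  "integrable_acs M J \<longleftrightarrow>
     (\<forall>X Y. vector_field M X \<longrightarrow> vector_field M Y \<longrightarrow> (\<forall>p\<in>M. nijenhuis M J X Y p = 0))"

definition maximally_non_integrable :: "'a::euclidean_space set \<Rightarrow> ('a \<Rightarrow> 'a \<Rightarrow> 'a) \<Rightarrow> bool" where
  "maximally_non_integrable M J \<longleftrightarrow>
     (\<forall>p\<in>M. span {nijenhuis M J X Y p | X Y. vector_field M X \<and> vector_field M Y}
              = tangent_space M p)"


section \<open>Hyperbolic space and its twistor space\<close>

text \<open>With \<open>n = CARD('n)\<close>, the coordinates of \<open>\<real>\<^bsup>2n\<^esup>\<close> are indexed by \<open>'n + 'n\<close> (the first \<open>n\<close>
  coordinates by \<open>Inl\<close>, the last \<open>n\<close> by \<open>Inr\<close>), and those of \<open>\<real>\<^bsup>1,2n\<^esup>\<close> by \<open>('n + 'n) option\<close>,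
  where \<open>None\<close> is the index of the time coordinate \<open>x\<^sup>0\<close>.\<close>

type_synonym 'n space_vec = "(real, 'n + 'n) vec"
type_synonym 'n space_mat = "(('n space_vec), 'n + 'n) vec"
type_synonym 'n lorentz_vec = "(real, ('n + 'n) option) vec"
type_synonym 'n lorentz_mat = "('n lorentz_vec, ('n + 'n) option) vec"

definition lorentz :: "'n::finite lorentz_vec \<Rightarrow> 'n lorentz_vec \<Rightarrow> real" where
  "lorentz x y = - (x $ None) * (y $ None) + (\<Sum>i\<in>UNIV. x $ Some i * y $ Some i)"

definition hyperbolic_space :: "'n::finite lorentz_vec set" where
  "hyperbolic_space = {x. lorentz x x = -1 \<and> x $ None > 0}"

text \<open>The orientation of the hyperbolic space is the one for which \<open>v\<close> is an oriented basis of the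
  tangent space at \<open>x\<close> iff \<open>(x, v)\<close> is an oriented basis of \<open>\<real>\<^bsup>1,2n\<^esup>\<close>; at \<open>e\<^sub>0\<close> it is the
  standard orientation of \<open>\<real>\<^bsup>2n\<^esup>\<close>.\<close>

definition oriented_orthonormal_basis ::
  "'n::finite lorentz_vec \<Rightarrow> ('n + 'n \<Rightarrow> 'n lorentz_vec) \<Rightarrow> bool" where
  "oriented_orthonormal_basis x v \<longleftrightarrow>
     (\<forall>i. v i \<in> tangent_space hyperbolic_space x) \<and>
     (\<forall>i k. lorentz (v i) (v k) = (if i = k then 1 else 0)) \<and>
     det (\<chi> r c. (case c of None \<Rightarrow> x | Some i \<Rightarrow> v i) $ r) > 0"

text \<open>A point of the twistor space is a pair \<open>(x, j)\<close>. The endomorphism \<open>j\<close> of the tangent space at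
  \<open>x\<close> (the Lorentz-orthogonal of \<open>x\<close>) is encoded as the matrix which extends it by \<open>j x = 0\<close>. This
  makes the twistor space an embedded submanifold of the space of all pairs (vector, matrix), and its
  second component is precisely the adjoint orbit of \<open>j0'\<close>.\<close>

type_synonym 'n twistor_point = "'n lorentz_vec \<times> 'n lorentz_mat"

definition twistor_space :: "'n::finite twistor_point set" where
  "twistor_space =
     {(x, j). x \<in> hyperbolic_space \<and> j *v x = 0 \<and>
        (\<exists>v. oriented_orthonormal_basis x v \<and>
             (\<forall>i. j *v v (Inl i) = v (Inr i) \<and> j *v v (Inr i) = - v (Inl i)))}"


section \<open>The action of the Lorentz group\<close>

text \<open>The connected component of the identity in \<open>SO(1,2n)\<close> consists of the elements which preserve
  the sheet \<open>x\<^sup>0 > 0\<close> of the hyperboloid.\<close>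

definition SO0 :: "'n::finite lorentz_mat set" where
  "SO0 = {A. (\<forall>x y. lorentz (A *v x) (A *v y) = lorentz x y) \<and> det A = 1 \<and> A $ None $ None > 0}"

definition so_lorentz :: "'n::finite lorentz_mat set" where
  "so_lorentz = {A. \<forall>x y. lorentz (A *v x) y + lorentz x (A *v y) = 0}"

definition block ::
  "real \<Rightarrow> 'n::finite space_vec \<Rightarrow> 'n space_vec \<Rightarrow> 'n space_mat \<Rightarrow> 'n lorentz_mat" where
  "block a r u B =
     (\<chi> i k. case i of
               None \<Rightarrow> (case k of None \<Rightarrow> a | Some k' \<Rightarrow> r $ k')
             | Some i' \<Rightarrow> (case k of None \<Rightarrow> u $ i' | Some k' \<Rightarrow> B $ i' $ k'))"

definition j0 :: "'n::finite space_mat" where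
  "j0 = (\<chi> i k. case i of
                   Inl a \<Rightarrow> (case k of Inl b \<Rightarrow> 0 | Inr b \<Rightarrow> if a = b then -1 else 0)
                 | Inr a \<Rightarrow> (case k of Inl b \<Rightarrow> if a = b then 1 else 0 | Inr b \<Rightarrow> 0))"

definition j0' :: "'n::finite lorentz_mat" where
  "j0' = block 0 0 0 j0"

definition twistor_base :: "'n::finite twistor_point" where
  "twistor_base = (axis None 1, j0')"

definition twistor_act :: "'n::finite lorentz_mat \<Rightarrow> 'n twistor_point \<Rightarrow> 'n twistor_point" where
  "twistor_act A = (\<lambda>(x, j). (A *v x, A ** j ** matrix_inv A))"

definition twistor_push :: "'n::finite lorentz_mat \<Rightarrow> 'n twistor_point \<Rightarrow> 'n twistor_point" where
  "twistor_push A = differential twistor_space (twistor_act A) twistor_base"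

definition pi1 :: "'n::finite lorentz_mat \<Rightarrow> 'n twistor_point" where
  "pi1 A = twistor_act A twistor_base"

definition pi1_diff :: "'n::finite lorentz_mat \<Rightarrow> 'n twistor_point" where
  "pi1_diff = differential SO0 pi1 (mat 1)"


section \<open>The invariant symplectic form and almost complex structures\<close>

text \<open>Both definitions transport the value at the base point by an arbitrary element \<open>A\<close> of the group
  which maps the base point to \<open>p\<close>, so that they are invariant by construction; the stabilizer \<open>U(n)\<close>
  of the base point preserves the values there, which makes the descriptions unique.\<close>

definition kks_form ::
  "'n::finite twistor_point \<Rightarrow> 'n twistor_point \<Rightarrow> 'n twistor_point \<Rightarrow> real" where
  "kks_form p v w =
     (THE r. \<exists>A\<in>SO0. \<exists>X\<in>so_lorentz. \<exists>Y\<in>so_lorentz.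
        twistor_act A twistor_base = p \<and>
        v = twistor_push A (pi1_diff X) \<and>
        w = twistor_push A (pi1_diff Y) \<and>
        r = - trace (j0' ** (X ** Y - Y ** X)))"

definition twistor_J :: "real \<Rightarrow> 'n::finite twistor_point \<Rightarrow> 'n twistor_point \<Rightarrow> 'n twistor_point" where
  "twistor_J s p v =
     (THE w. \<exists>A\<in>SO0. \<exists>u B.
        transpose B = - B \<and> B ** j0 = - (j0 ** B) \<and>
        twistor_act A twistor_base = p \<and>
        v = twistor_push A (pi1_diff (block 0 u u B)) \<and>
        w = twistor_push A (pi1_diff (block 0 (s *\<^sub>R (j0 *v u)) (s *\<^sub>R (j0 *v u)) (j0 ** B))))"

definition J_plus :: "'n::finite twistor_point \<Rightarrow> 'n twistor_point \<Rightarrow> 'n twistor_point" where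
  "J_plus = twistor_J 1"

definition J_minus :: "'n::finite twistor_point \<Rightarrow> 'n twistor_point \<Rightarrow> 'n twistor_point" where
  "J_minus = twistor_J (-1)"

end

theory Submission
  imports Defs
begin

text \<open>In the ambient space of pairs \<open>(x, j)\<close>, with \<open>y\<^sup>* = lorentz y\<close>, the twistor space satisfies
  the quadratic equations \<open>x\<^sup>*x = -1\<close>, \<open>j x = 0\<close>, \<open>j\<^sup>2 = -1 - x x\<^sup>*\<close> and the linear equation
  \<open>ladj j = - j\<close>, and its tangent spaces are cut out by the linearized equations. On tangent vectors
  \<open>(\<xi>, k)\<close> the two structures and the symplectic form are restrictions of polynomials:
  \<open>J\<^sup>s (\<xi>, k) = (s j \<xi>, j k + (1-s) \<xi> x\<^sup>* + s x \<xi>\<^sup>*)\<close> for \<open>s = 1, -1\<close>, which is bilinear in point and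
  vector, and \<open>\<omega> = -1/2 Tr (j k k') - 3/2 (j \<xi>)\<^sup>*\<xi>'\<close>. Hence the Nijenhuis tensor and \<open>d \<omega>\<close> are
  algebraic expressions in the tangent vectors. By invariance they only have to be evaluated at the
  base point, where tangent vectors are pairs \<open>(u, B)\<close> and
  \<open>\<omega> (v, J\<^sup>s v') = - 2 s u \<bullet> u' - 2 Tr (B B')\<close>.\<close>

section \<open>Smooth maps and differentials\<close>

text \<open>Differentials on the twistor space may be computed with any ambient extension. For
  bilinear extensions the product rule leaves derivatives of the vector fields and derivatives in
  the point; the former cancel because brackets of tangent fields are tangent, and the latter are
  the algebraic expressions that remain. The obstacle is the converse half of the description of
  tangent spaces: each solution of the linearized equations must be the velocity of a curve inside
  the twistor space. Products of polynomial null rotations supply such curves for every element of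
  the Lie algebra. For \<open>J_minus\<close>, the Nijenhuis tensor maps two horizontal vectors to a
  vertical one, and these values fill the fibre directions; a vertical and a horizontal vector give
  values with arbitrary horizontal part. The second kind needs a fibre of positive dimension, which
  is the source of the condition \<open>CARD('n) \<ge> 2\<close>.\<close>

lemma has_derivative_frechet:
  "f differentiable (at x) \<Longrightarrow> (f has_derivative frechet_derivative f (at x)) (at x)"
  by (simp add: frechet_derivative_works)

lemma frechet_derivative_cong_open:
  assumes "open U" "x \<in> U" "\<And>y. y \<in> U \<Longrightarrow> f y = g y"
  shows "frechet_derivative f (at x) = frechet_derivative g (at x)"
proof -
  have "(f has_derivative D) (at x) \<longleftrightarrow> (g has_derivative D) (at x)" for D
    using assms has_derivative_transform_within_open[of f D x UNIV U g]
      has_derivative_transform_within_open[of g D x UNIV U f] by auto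
  then show ?thesis by (simp add: frechet_derivative_def)
qed

lemma differentiable_cong_open:
  assumes "open U" "x \<in> U" "\<And>y. y \<in> U \<Longrightarrow> f y = g y" "f differentiable (at x)"
  shows "g differentiable (at x)"
  using assms has_derivative_transform_within_open[of f _ x UNIV U g]
  unfolding differentiable_def by blast

lemma Ck_on_cong:
  assumes "open U" "\<And>y. y \<in> U \<Longrightarrow> f y = g y" "Ck_on k U f"
  shows "Ck_on k U g"
  using assms(2,3)
proof (induction k arbitrary: f g)
  case 0
  then show ?case using continuous_on_cong[of U U f g] by simp
next
  case (Suc k)
  have "g differentiable (at x)" if "x \<in> U" for x
    using differentiable_cong_open[OF assms(1) that, of f g] Suc.prems that by simp
  moreover have "Ck_on k U (\<lambda>x. frechet_derivative g (at x) v)" for v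
    by (rule Suc.IH[of "\<lambda>x. frechet_derivative f (at x) v"])
       (use Suc.prems frechet_derivative_cong_open[OF assms(1), of _ f g] in auto)
  ultimately show ?case by simp
qed

text \<open>Any explicit derivative may replace the chosen \<open>frechet_derivative\<close>, which
  makes the calculus rules below provable by induction on \<open>k\<close>.\<close>

lemma Ck_on_SucI:
  assumes "open U" "\<And>x. x \<in> U \<Longrightarrow> (f has_derivative f' x) (at x)"
    and "\<And>v. Ck_on k U (\<lambda>x. f' x v)"
  shows "Ck_on (Suc k) U f"
proof -
  have "Ck_on k U (\<lambda>x. frechet_derivative f (at x) v)" for v
    by (rule Ck_on_cong[OF assms(1) _ assms(3)[of v]]) (metis assms(2) frechet_derivative_at)
  then show ?thesis using assms(2) by (auto simp: differentiable_def)
qed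

lemma Ck_on_SucD: "Ck_on (Suc k) U f \<Longrightarrow> Ck_on k U f"
proof (induction k arbitrary: f)
  case 0
  then show ?case
    by (auto intro!: continuous_at_imp_continuous_on differentiable_imp_continuous_within)
qed auto

lemma Ck_on_const: "Ck_on k U (\<lambda>x. c)"
  by (induction k arbitrary: c) (auto simp: frechet_derivative_const)

lemma Ck_on_add:
  assumes "open U" "Ck_on k U f" "Ck_on k U g"
  shows "Ck_on k U (\<lambda>x. f x + g x)"
  using assms(2,3)
proof (induction k arbitrary: f g)
  case 0
  then show ?case by (auto intro!: continuous_on_add)
next
  case (Suc k)
  show ?case
    by (rule Ck_on_SucI[where f' = "\<lambda>x v. frechet_derivative f (at x) v + frechet_derivative g (at x) v"])
       (use Suc assms(1) in \<open>auto intro!: has_derivative_add has_derivative_frechet\<close>)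
qed

lemma Ck_on_linear:
  assumes "open U" "bounded_linear h" "Ck_on k U f"
  shows "Ck_on k U (\<lambda>x. h (f x))"
  using assms(3)
proof (induction k arbitrary: f)
  case 0
  then show ?case using assms(2)
    by (auto intro: bounded_linear.continuous_on)
next
  case (Suc k)
  have "((\<lambda>x. h (f x)) has_derivative (\<lambda>v. h (frechet_derivative f (at x) v))) (at x)"
    if "x \<in> U" for x
    using Suc.prems that bounded_linear.has_derivative[OF assms(2) has_derivative_frechet, of f x] by simp
  moreover have "Ck_on k U (\<lambda>x. h (frechet_derivative f (at x) v))" for v
    by (rule Suc.IH) (use Suc.prems in simp)
  ultimately show ?case
    using Ck_on_SucI[OF assms(1), of "\<lambda>x. h (f x)" "\<lambda>x v. h (frechet_derivative f (at x) v)" k] by blast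
qed

text \<open>The smooth maps constructed below arise from constants, the identity and given smooth
  maps by sums, pairs, linear and bilinear maps, so this product rule takes the place of a chain
  rule for smooth maps.\<close>

lemma Ck_on_bilinear:
  assumes "open U" "bounded_bilinear h" "Ck_on k U f" "Ck_on k U g"
  shows "Ck_on k U (\<lambda>x. h (f x) (g x))"
  using assms(3,4)
proof (induction k arbitrary: f g)
  case 0
  then show ?case using assms(2) by (auto intro: bounded_bilinear.continuous_on)
next
  case (Suc k)
  \<comment> \<open>In each summand of the product rule one factor stays undifferentiated, and the
    induction hypothesis asks for it in class \<open>k\<close>.\<close>
  have fg: "Ck_on k U f" "Ck_on k U g" using Suc.prems Ck_on_SucD by blast+
  have "Ck_on k U (\<lambda>x. h (f x) (frechet_derivative g (at x) v))" for v
    by (rule Suc.IH[OF fg(1)]) (use Suc.prems in simp)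
  moreover have "Ck_on k U (\<lambda>x. h (frechet_derivative f (at x) v) (g x))" for v
    by (rule Suc.IH[OF _ fg(2)]) (use Suc.prems in simp)
  ultimately have 1: "Ck_on k U (\<lambda>x. h (f x) (frechet_derivative g (at x) v)
      + h (frechet_derivative f (at x) v) (g x))" for v
    using Ck_on_add[OF assms(1)] by blast
  have 2: "((\<lambda>x. h (f x) (g x)) has_derivative (\<lambda>v. h (f x) (frechet_derivative g (at x) v)
      + h (frechet_derivative f (at x) v) (g x))) (at x)" if "x \<in> U" for x
    using Suc.prems that
      bounded_bilinear.FDERIV[OF assms(2) has_derivative_frechet has_derivative_frechet, of f x g] by simp
  show ?case by (rule Ck_on_SucI[OF assms(1) 2 1])
qed

lemma Ck_on_id:
  assumes "open U"
  shows "Ck_on k U (\<lambda>x. x)"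
proof (cases k)
  case (Suc m)
  then show ?thesis using assms
    by (auto intro!: Ck_on_SucI[where f' = "\<lambda>x v. v"] Ck_on_const)
qed auto

lemma smooth_on_const: "smooth_on U (\<lambda>x. c)"
  by (simp add: smooth_on_def Ck_on_const)

lemma smooth_on_id: "open U \<Longrightarrow> smooth_on U (\<lambda>x. x)"
  by (simp add: smooth_on_def Ck_on_id)

lemma smooth_on_add: "open U \<Longrightarrow> smooth_on U f \<Longrightarrow> smooth_on U g \<Longrightarrow> smooth_on U (\<lambda>x. f x + g x)"
  using Ck_on_add[of U _ f g] by (auto simp: smooth_on_def)

lemma smooth_on_linear: "open U \<Longrightarrow> bounded_linear l \<Longrightarrow> smooth_on U f \<Longrightarrow> smooth_on U (\<lambda>x. l (f x))"
  using Ck_on_linear[of U l _ f] by (auto simp: smooth_on_def)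

lemma smooth_on_bilinear:
  "open U \<Longrightarrow> bounded_bilinear h \<Longrightarrow> smooth_on U f \<Longrightarrow> smooth_on U g
    \<Longrightarrow> smooth_on U (\<lambda>x. h (f x) (g x))"
  using Ck_on_bilinear[of U h _ f g] by (auto simp: smooth_on_def)

lemma smooth_on_Pair:
  assumes "open U" "smooth_on U f" "smooth_on U g"
  shows "smooth_on U (\<lambda>x. (f x, g x))"
proof -
  have "smooth_on U (\<lambda>x. (f x, 0) + (0, g x))"
    using smooth_on_add[OF assms(1), of "\<lambda>x. (f x, 0)" "\<lambda>x. (0, g x)"]
      smooth_on_linear[OF assms(1), of "\<lambda>y. (y, 0)" f] smooth_on_linear[OF assms(1), of "\<lambda>y. (0, y)" g] assms
    by (simp add: bounded_linear_Pair bounded_linear_ident bounded_linear_zero)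
  then show ?thesis by simp
qed

lemma Ck_on_subset:
  assumes "U \<subseteq> V" "Ck_on k V f"
  shows "Ck_on k U f"
  using assms(2)
proof (induction k arbitrary: f)
  case 0
  then show ?case using assms(1) continuous_on_subset by auto
next
  case (Suc k)
  have "Ck_on k U (\<lambda>x. frechet_derivative f (at x) v)" for v
    by (rule Suc.IH) (use Suc.prems in simp)
  then show ?case using Suc.prems assms(1) by (simp add: subset_iff)
qed

lemma smooth_on_subset: "U \<subseteq> V \<Longrightarrow> smooth_on V f \<Longrightarrow> smooth_on U f"
  using Ck_on_subset[of U V _ f] by (auto simp: smooth_on_def)

lemma smooth_on_has_derivative:
  assumes "smooth_on U f" "x \<in> U"
  shows "(f has_derivative frechet_derivative f (at x)) (at x)"
proof -
  have "Ck_on (Suc 0) U f" using assms(1) unfolding smooth_on_def by blast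
  then show ?thesis using assms(2) by (simp add: has_derivative_frechet)
qed

lemma smooth_map_on_UNIV: "smooth_on UNIV g \<Longrightarrow> (\<And>q. q \<in> S \<Longrightarrow> g q = f q) \<Longrightarrow> smooth_map_on S f"
  unfolding smooth_map_on_def by blast

section \<open>Differentials and brackets on an embedded submanifold\<close>

lemma curve_derivative_unique:
  assumes \<gamma>: "curve_through M p v \<gamma>" and U: "open U" "p \<in> U" "\<And>q. q \<in> M \<inter> U \<Longrightarrow> g q = f q"
    and g: "(g has_derivative g') (at p)"
  shows "((f \<circ> \<gamma>) has_vector_derivative g' v) (at 0)"
proof -
  obtain e where e: "e > 0" "\<gamma> ` {-e<..<e} \<subseteq> M"
    and \<gamma>0: "\<gamma> 0 = p" "(\<gamma> has_vector_derivative v) (at 0)"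
    using \<gamma> unfolding curve_through_def by blast
  have "((\<lambda>t. g (\<gamma> t)) has_derivative (\<lambda>t. g' (t *\<^sub>R v))) (at 0)"
    by (rule has_derivative_compose[OF \<gamma>0(2)[unfolded has_vector_derivative_def]])
      (use g \<gamma>0(1) in simp)
  then have d: "((\<lambda>t. g (\<gamma> t)) has_vector_derivative g' v) (at 0)"
    using has_derivative_linear[OF g] by (simp add: has_vector_derivative_def linear_cmul)
  have "continuous (at 0) \<gamma>"
    using \<gamma>0(2) has_derivative_continuous has_vector_derivative_def by blast
  then have "eventually (\<lambda>t. \<gamma> t \<in> U) (at 0)"
    using U(1,2) \<gamma>0(1) by (auto simp: isCont_def dest: topological_tendstoD)
  moreover have "eventually (\<lambda>t. t \<in> {-e<..<e}) (at (0::real))"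
    using e(1) by (intro eventually_at_in_open') auto
  ultimately have "eventually (\<lambda>t. g (\<gamma> t) = (f \<circ> \<gamma>) t) (at 0)"
    by eventually_elim (use e U(3) in \<open>auto simp: image_subset_iff\<close>)
  moreover have "g (\<gamma> 0) = (f \<circ> \<gamma>) 0"
    using e U(2) U(3)[of p] \<gamma>0(1) by (force simp: image_subset_iff)
  ultimately show ?thesis
    using d has_derivative_transform_eventually[of "\<lambda>t. g (\<gamma> t)" _ 0 UNIV "f \<circ> \<gamma>"]
    unfolding has_vector_derivative_def by auto
qed

text \<open>By the chain rule every curve with velocity \<open>v\<close> yields \<open>g' v\<close>,
  so the definite description has this value whichever local extension \<open>g\<close> is
  taken.\<close>

lemma differential_eq:
  assumes v: "v \<in> tangent_space M p" and U: "open U" "p \<in> U" "\<And>q. q \<in> M \<inter> U \<Longrightarrow> g q = f q"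
    and g: "(g has_derivative g') (at p)"
  shows "differential M f p v = g' v"
proof -
  obtain \<gamma> where \<gamma>: "curve_through M p v \<gamma>" using v unfolding tangent_space_def by blast
  show ?thesis unfolding differential_def
    by (rule the_equality)
       (use \<gamma> curve_derivative_unique[OF _ U g] vector_derivative_unique_at in blast)+
qed

lemma vector_field_extension:
  assumes "vector_field M X" "p \<in> M"
  obtains U g g' where "open U" "p \<in> U" "\<And>q. q \<in> M \<inter> U \<Longrightarrow> g q = X q"
    "(g has_derivative g') (at p)" "g p = X p" "bounded_linear g'"
  using assms smooth_on_has_derivative has_derivative_bounded_linear
  unfolding vector_field_def smooth_map_on_def by (metis IntI)

text \<open>A bracket of tangent fields is tangent: differentiating \<open>Psi q (Y q) = 0\<close> along \<open>X\<close> leaves the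
  term \<open>Psi (X p) (Y p)\<close>, which is symmetric in \<open>X\<close> and \<open>Y\<close>.\<close>

lemma bracket_constraint:
  fixes Psi :: "'a::euclidean_space \<Rightarrow> 'a \<Rightarrow> 'c::euclidean_space"
  assumes X: "vector_field M X" and Y: "vector_field M Y" and p: "p \<in> M"
    and Psi: "bounded_bilinear Psi" and sym: "\<And>v w. Psi v w = Psi w v"
    and T: "\<And>q v. q \<in> M \<Longrightarrow> v \<in> tangent_space M q \<Longrightarrow> Psi q v = 0"
  shows "Psi p (lie_bracket M X Y p) = 0"
proof -
  interpret bounded_bilinear Psi by fact
  have *: "Psi p (differential M Y p (X p)) = - Psi (X p) (Y p)"
    if X: "vector_field M X" and Y: "vector_field M Y" for X Y
  proof -
    obtain U g g' where g: "open U" "p \<in> U" "\<And>q. q \<in> M \<inter> U \<Longrightarrow> g q = Y q"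
      "(g has_derivative g') (at p)" "g p = Y p" "bounded_linear g'"
      using vector_field_extension[OF Y p] by metis
    have Xp: "X p \<in> tangent_space M p" using X p by (auto simp: vector_field_def)
    have "((\<lambda>q. Psi q (g q)) has_derivative (\<lambda>h. Psi p (g' h) + Psi h (g p))) (at p)"
      by (rule FDERIV[OF has_derivative_ident g(4)])
    then have "differential M (\<lambda>q. 0) p (X p) = Psi p (g' (X p)) + Psi (X p) (g p)"
      by (intro differential_eq[OF Xp g(1,2)]) (use g(3) T Y in \<open>auto simp: vector_field_def\<close>)
    moreover have "differential M (\<lambda>q. 0) p (X p) = (0::'c)"
      by (rule differential_eq[OF Xp g(1,2), where g = "\<lambda>q. 0" and g' = "\<lambda>q. 0"]) auto
    moreover have "differential M Y p (X p) = g' (X p)"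
      by (rule differential_eq[OF Xp g(1-4)]) auto
    ultimately show ?thesis using g(5) by (metis add_eq_0_iff2)
  qed
  show ?thesis
    using *[OF X Y] *[OF Y X] sym[of "X p"] by (simp add: lie_bracket_def diff_right)
qed

text \<open>As \<open>L\<close> does not vary with the point, differentiating
  \<open>L (Y q) = 0\<close> along a tangent vector annihilates each of the two derivatives in the
  bracket separately.\<close>

lemma bracket_linear_constraint:
  fixes L :: "'a::euclidean_space \<Rightarrow> 'c::euclidean_space"
  assumes X: "vector_field M X" and Y: "vector_field M Y" and p: "p \<in> M"
    and L: "bounded_linear L"
    and T: "\<And>q v. q \<in> M \<Longrightarrow> v \<in> tangent_space M q \<Longrightarrow> L v = 0"
  shows "L (lie_bracket M X Y p) = 0"
proof -
  have *: "L (differential M Y p (X p)) = 0"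
    if X: "vector_field M X" and Y: "vector_field M Y" for X Y
  proof -
    obtain U g g' where g: "open U" "p \<in> U" "\<And>q. q \<in> M \<inter> U \<Longrightarrow> g q = Y q"
      "(g has_derivative g') (at p)" "g p = Y p" "bounded_linear g'"
      using vector_field_extension[OF Y p] by metis
    have Xp: "X p \<in> tangent_space M p" using X p by (auto simp: vector_field_def)
    have "((\<lambda>q. L (g q)) has_derivative (\<lambda>h. L (g' h))) (at p)"
      by (rule bounded_linear.has_derivative[OF L g(4)])
    then have "differential M (\<lambda>q. 0) p (X p) = L (g' (X p))"
      by (intro differential_eq[OF Xp g(1,2)]) (use g(3) T Y in \<open>auto simp: vector_field_def\<close>)
    moreover have "differential M (\<lambda>q. 0) p (X p) = (0::'c)"
      by (rule differential_eq[OF Xp g(1,2), where g = "\<lambda>q. 0" and g' = "\<lambda>q. 0"]) auto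
    moreover have "differential M Y p (X p) = g' (X p)"
      by (rule differential_eq[OF Xp g(1-4)]) auto
    ultimately show ?thesis by metis
  qed
  show ?thesis using *[OF X Y] *[OF Y X] L
    by (simp add: lie_bracket_def linear_diff bounded_linear.linear)
qed

text \<open>The four brackets contain derivatives of the fields and derivatives of \<open>B\<close>
  in the point. The former cancel because \<open>J\<close> squares to minus the identity; since
  \<open>B\<close> is linear in the point, the latter are values of \<open>B\<close> itself.\<close>

lemma nijenhuis_bilinear:
  assumes X: "vector_field M X" and Y: "vector_field M Y" and p: "p \<in> M"
    and B: "bounded_bilinear B"
    and J: "\<And>q v. q \<in> M \<Longrightarrow> v \<in> tangent_space M q \<Longrightarrow>
         J q v = B q v \<and> B q v \<in> tangent_space M q \<and> B q (B q v) = - v"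
    and br: "\<And>X Y. vector_field M X \<Longrightarrow> vector_field M Y \<Longrightarrow> lie_bracket M X Y p \<in> tangent_space M p"
    and JF: "\<And>X. vector_field M X \<Longrightarrow> vector_field M (\<lambda>q. J q (X q))"
  shows "nijenhuis M J X Y p = B (B p (X p)) (Y p) - B (B p (Y p)) (X p)
    - B p (B (X p) (Y p) - B (Y p) (X p))"
proof -
  interpret bounded_bilinear B by fact
  have tan: "X q \<in> tangent_space M q" if "vector_field M X" "q \<in> M" for X q
    using that by (auto simp: vector_field_def)
  obtain U g g' where g: "open U" "p \<in> U" "\<And>q. q \<in> M \<inter> U \<Longrightarrow> g q = X q"
    "(g has_derivative g') (at p)" "g p = X p" "bounded_linear g'"
    using vector_field_extension[OF X p] by metis
  obtain V h h' where h: "open V" "p \<in> V" "\<And>q. q \<in> M \<inter> V \<Longrightarrow> h q = Y q"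
    "(h has_derivative h') (at p)" "h p = Y p" "bounded_linear h'"
    using vector_field_extension[OF Y p] by metis
  have dX: "differential M X p v = g' v" and dY: "differential M Y p v = h' v"
    if "v \<in> tangent_space M p" for v
    using differential_eq[OF that g(1-4)] differential_eq[OF that h(1-4)] by auto
  have dJX: "differential M (\<lambda>q. J q (X q)) p v = B p (g' v) + B v (X p)"
    if "v \<in> tangent_space M p" for v
    using differential_eq[OF that g(1,2), of "\<lambda>q. B q (g q)" "\<lambda>q. J q (X q)"]
      FDERIV[OF has_derivative_ident g(4)] g(3,5) J tan[OF X] by simp
  have dJY: "differential M (\<lambda>q. J q (Y q)) p v = B p (h' v) + B v (Y p)"
    if "v \<in> tangent_space M p" for v
    using differential_eq[OF that h(1,2), of "\<lambda>q. B q (h q)" "\<lambda>q. J q (Y q)"]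
      FDERIV[OF has_derivative_ident h(4)] h(3,5) J tan[OF Y] by simp
  have XY: "X p \<in> tangent_space M p" "Y p \<in> tangent_space M p" using tan X Y p by auto
  note Jp = J[OF p]
  have b: "lie_bracket M X Y p = h' (X p) - g' (Y p)"
    using XY by (simp add: lie_bracket_def dX dY)
  \<comment> \<open>Neither \<open>h' (X p)\<close> nor \<open>g' (Y p)\<close> need be tangent.
    Only their difference, the bracket, is known to be, so \<open>B p\<close> is squared on the
    difference.\<close>
  have BB: "B p (B p (h' (X p))) - B p (B p (g' (Y p))) = - (h' (X p) - g' (Y p))"
    using Jp[OF br[OF X Y]] b by (simp add: diff_right)
  have b1: "lie_bracket M (\<lambda>q. J q (X q)) Y p = h' (B p (X p)) - B p (g' (Y p)) - B (Y p) (X p)"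
    using XY Jp by (simp add: lie_bracket_def dY dJX)
  have b2: "lie_bracket M X (\<lambda>q. J q (Y q)) p = B p (h' (X p)) + B (X p) (Y p) - g' (B p (Y p))"
    using XY Jp by (simp add: lie_bracket_def dX dJY)
  have b3: "lie_bracket M (\<lambda>q. J q (X q)) (\<lambda>q. J q (Y q)) p =
     B p (h' (B p (X p))) + B (B p (X p)) (Y p) - B p (g' (B p (Y p))) - B (B p (Y p)) (X p)"
    using XY Jp by (simp add: lie_bracket_def dJX dJY)
  have j1: "J p (lie_bracket M (\<lambda>q. J q (X q)) Y p) = B p (lie_bracket M (\<lambda>q. J q (X q)) Y p)"
    and j2: "J p (lie_bracket M X (\<lambda>q. J q (Y q)) p) = B p (lie_bracket M X (\<lambda>q. J q (Y q)) p)"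
    using Jp br JF X Y by blast+
  show ?thesis
    unfolding nijenhuis_def j1 j2 unfolding b1 b2 b3 b using BB
    by (simp add: diff_right add_right algebra_simps)
qed

text \<open>Derivatives of the fields cancel against the bracket terms, leaving the derivative of
  the form in the point. Single derivatives such as \<open>differential M Z p (X p)\<close> may
  leave the tangent space, hence \<open>anti\<close> for all ambient vectors.\<close>

lemma exterior_deriv2_trilinear:
  assumes X: "vector_field M X" and Y: "vector_field M Y" and Z: "vector_field M Z" and p: "p \<in> M"
    and B: "bounded_bilinear B" and P: "bounded_bilinear P"
    and W: "\<And>q v w. q \<in> M \<Longrightarrow> v \<in> tangent_space M q \<Longrightarrow> w \<in> tangent_space M q \<Longrightarrow> \<omega> q v w = P (B q v) w"
    and anti: "\<And>q v w. P (B q v) w = - P (B q w) v"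
    and br: "\<And>X Y. vector_field M X \<Longrightarrow> vector_field M Y \<Longrightarrow> lie_bracket M X Y p \<in> tangent_space M p"
  shows "exterior_deriv2 M \<omega> X Y Z p =
     P (B (X p) (Y p)) (Z p) + P (B (Y p) (Z p)) (X p) + P (B (Z p) (X p)) (Y p)"
proof -
  interpret B: bounded_bilinear B by fact
  interpret P: bounded_bilinear P by fact
  have tan: "X q \<in> tangent_space M q" if "vector_field M X" "q \<in> M" for X q
    using that by (auto simp: vector_field_def)
  have *: "differential M (\<lambda>q. \<omega> q (Y q) (Z q)) p v = P (B v (Y p)) (Z p)
      + P (B p (differential M Y p v)) (Z p) + P (B p (Y p)) (differential M Z p v)"
    if Y: "vector_field M Y" and Z: "vector_field M Z" and v: "v \<in> tangent_space M p" for Y Z v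
  proof -
    obtain U g g' where g: "open U" "p \<in> U" "\<And>q. q \<in> M \<inter> U \<Longrightarrow> g q = Y q"
      "(g has_derivative g') (at p)" "g p = Y p" "bounded_linear g'"
      using vector_field_extension[OF Y p] by metis
    obtain V h h' where h: "open V" "p \<in> V" "\<And>q. q \<in> M \<inter> V \<Longrightarrow> h q = Z q"
      "(h has_derivative h') (at p)" "h p = Z p" "bounded_linear h'"
      using vector_field_extension[OF Z p] by metis
    have d: "((\<lambda>q. P (B q (g q)) (h q)) has_derivative
        (\<lambda>v. P (B p (g p)) (h' v) + P (B p (g' v) + B v (g p)) (h p))) (at p)"
      by (rule P.FDERIV[OF B.FDERIV[OF has_derivative_ident g(4)] h(4)])
    have "differential M (\<lambda>q. \<omega> q (Y q) (Z q)) p v =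
        P (B p (g p)) (h' v) + P (B p (g' v) + B v (g p)) (h p)"
      by (rule differential_eq[OF v _ _ _ d, of "U \<inter> V"])
         (use g h W tan[OF Y] tan[OF Z] in auto)
    then show ?thesis
      using differential_eq[OF v g(1-4)] differential_eq[OF v h(1-4)] g(5) h(5)
      by (simp add: P.add_left)
  qed
  have XYZ: "X p \<in> tangent_space M p" "Y p \<in> tangent_space M p" "Z p \<in> tangent_space M p"
    using tan X Y Z p by auto
  have "exterior_deriv2 M \<omega> X Y Z p =
       P (B (X p) (Y p)) (Z p) + P (B p (differential M Y p (X p))) (Z p) + P (B p (Y p)) (differential M Z p (X p))
     + (P (B (Y p) (Z p)) (X p) + P (B p (differential M Z p (Y p))) (X p) + P (B p (Z p)) (differential M X p (Y p)))
     + (P (B (Z p) (X p)) (Y p) + P (B p (differential M X p (Z p))) (Y p) + P (B p (X p)) (differential M Y p (Z p)))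
     - P (B p (lie_bracket M X Y p)) (Z p) - P (B p (lie_bracket M Y Z p)) (X p)
     - P (B p (lie_bracket M Z X p)) (Y p)"
    unfolding exterior_deriv2_def
    using *[OF Y Z XYZ(1)] *[OF Z X XYZ(2)] *[OF X Y XYZ(3)] W[OF p] br X Y Z XYZ by simp
  then show ?thesis
    using anti[of p "Y p" "differential M Z p (X p)"] anti[of p "Z p" "differential M X p (Y p)"]
      anti[of p "X p" "differential M Y p (Z p)"]
    by (simp add: lie_bracket_def B.diff_right P.diff_left)
qed

section \<open>The Lorentz adjoint\<close>

definition sgl :: "'a option \<Rightarrow> real" where
  "sgl i = (case i of None \<Rightarrow> - 1 | Some _ \<Rightarrow> 1)"

lemma sgl_simps [simp]: "sgl None = - 1" "sgl (Some i) = 1"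
  by (simp_all add: sgl_def)

lemma sgl_sq [simp]: "sgl i * sgl i = 1" "sgl i * (sgl i * r) = r"
  by (cases i; simp)+

lemma sum_option: "sum f UNIV = f None + (\<Sum>i\<in>UNIV. f (Some i))" for f :: "'a::finite option \<Rightarrow> real"
  by (simp add: UNIV_option_conv sum.reindex)

text \<open>The rank-one operator \<open>x y\<^sup>*\<close>; the factor \<open>sgl k\<close> lowers
  the index of \<open>y\<close>.\<close>

definition outer :: "'n::finite lorentz_vec \<Rightarrow> 'n lorentz_vec \<Rightarrow> 'n lorentz_mat" where
  "outer x y = (\<chi> i k. x $ i * (sgl k * y $ k))"

text \<open>The adjoint for \<open>lorentz\<close>: the transpose conjugated by the signature
  matrix. It is linear and inverts isometries, so that inverses in the group become
  polynomial.\<close>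

definition ladj :: "'n::finite lorentz_mat \<Rightarrow> 'n lorentz_mat" where
  "ladj A = (\<chi> i k. sgl i * sgl k * A $ k $ i)"

lemma lorentz_alt: "lorentz x y = (\<Sum>i\<in>UNIV. sgl i * (x $ i * y $ i))"
  by (simp add: lorentz_def sum_option)

lemma bilinear_bounded:
  fixes h :: "'a::euclidean_space \<Rightarrow> 'b::euclidean_space \<Rightarrow> 'c::real_normed_vector"
  assumes "\<And>x y z. h (x + y) z = h x z + h y z" "\<And>x y z. h x (y + z) = h x y + h x z"
    "\<And>r x y. h (r *\<^sub>R x) y = r *\<^sub>R h x y" "\<And>r x y. h x (r *\<^sub>R y) = r *\<^sub>R h x y"
  shows "bounded_bilinear h"
  using assms by (simp add: bilinear_conv_bounded_bilinear[symmetric] bilinear_def linear_iff)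

lemma bounded_bilinear_lorentz: "bounded_bilinear lorentz"
  by (rule bilinear_bounded)
     (simp_all add: lorentz_alt algebra_simps sum.distrib sum_distrib_left)

lemma bounded_bilinear_outer: "bounded_bilinear outer"
  by (rule bilinear_bounded) (simp_all add: outer_def vec_eq_iff algebra_simps)

lemma bounded_bilinear_mm: "bounded_bilinear ((**) :: real^'a::finite^'b::finite \<Rightarrow> real^'c::finite^'a \<Rightarrow> _)"
  by (rule bilinear_bounded)
     (simp_all add: matrix_matrix_mult_def vec_eq_iff algebra_simps sum.distrib sum_distrib_left)

lemma bounded_bilinear_mv: "bounded_bilinear ((*v) :: real^'a::finite^'b::finite \<Rightarrow> _)"
  by (rule bilinear_bounded)
     (simp_all add: matrix_vector_mult_def vec_eq_iff algebra_simps sum.distrib sum_distrib_left)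

interpretation lor: bounded_bilinear lorentz by (rule bounded_bilinear_lorentz)
interpretation out: bounded_bilinear outer by (rule bounded_bilinear_outer)
interpretation mm: bounded_bilinear "(**) :: real^'a::finite^'b::finite \<Rightarrow> real^'c::finite^'a \<Rightarrow> _"
  by (rule bounded_bilinear_mm)
interpretation mv: bounded_bilinear "(*v) :: real^'a::finite^'b::finite \<Rightarrow> _"
  by (rule bounded_bilinear_mv)

lemmas bil_simps = lor.add_left lor.add_right lor.diff_left lor.diff_right lor.minus_left lor.minus_right
  lor.scaleR_left lor.scaleR_right lor.zero_left lor.zero_right
  out.add_left out.add_right out.diff_left out.diff_right out.minus_left out.minus_right
  out.scaleR_left out.scaleR_right out.zero_left out.zero_right
  mm.add_left mm.add_right mm.diff_left mm.diff_right mm.minus_left mm.minus_right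
  mm.scaleR_left mm.scaleR_right mm.zero_left mm.zero_right
  mv.add_left mv.add_right mv.diff_left mv.diff_right mv.minus_left mv.minus_right
  mv.scaleR_left mv.scaleR_right mv.zero_left mv.zero_right

lemma lorentz_commute: "lorentz x y = lorentz y x"
  by (simp add: lorentz_alt mult.commute)

lemma lorentz_axis: "lorentz x (axis i 1) = sgl i * x $ i"
  by (simp add: lorentz_alt axis_def if_distrib[of "\<lambda>y. _ * y"] cong: if_cong)

lemma lorentz_eqI: "(\<And>z. lorentz x z = lorentz y z) \<Longrightarrow> x = y"
proof -
  assume *: "\<And>z. lorentz x z = lorentz y z"
  show "x = y"
  proof (rule vec_eq_iff[THEN iffD2], rule allI)
    show "x $ i = y $ i" for i using *[of "axis i 1"] by (cases i) (simp_all add: lorentz_axis)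
  qed
qed

lemma lorentz_ladj: "lorentz (A *v x) y = lorentz x (ladj A *v y)"
proof -
  have "lorentz (A *v x) y = (\<Sum>i\<in>UNIV. \<Sum>k\<in>UNIV. sgl i * A $ i $ k * x $ k * y $ i)"
    by (simp add: lorentz_alt matrix_vector_mult_def sum_distrib_left sum_distrib_right algebra_simps)
  also have "\<dots> = (\<Sum>k\<in>UNIV. \<Sum>i\<in>UNIV. sgl i * A $ i $ k * x $ k * y $ i)"
    by (rule sum.swap)
  also have "\<dots> = lorentz x (ladj A *v y)"
    by (simp add: lorentz_alt matrix_vector_mult_def ladj_def sum_distrib_left algebra_simps)
  finally show ?thesis .
qed

lemma ladj_unique:
  assumes "\<And>x y. lorentz (A *v x) y = lorentz x (B *v y)"
  shows "ladj A = B"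
proof -
  have "ladj A *v y = B *v y" for y
    by (rule lorentz_eqI) (metis assms lorentz_commute lorentz_ladj)
  then show ?thesis by (simp add: matrix_eq)
qed

lemma outer_mv [simp]: "outer x y *v z = lorentz y z *\<^sub>R x"
  by (simp add: outer_def matrix_vector_mult_def vec_eq_iff lorentz_alt sum_distrib_left algebra_simps)

lemma ladj_ladj [simp]: "ladj (ladj A) = A"
  by (simp add: ladj_def vec_eq_iff)

lemma linear_ladj: "linear ladj"
  by (simp add: linear_iff ladj_def vec_eq_iff algebra_simps)

lemma bounded_linear_ladj: "bounded_linear ladj"
  using linear_ladj by (simp add: linear_conv_bounded_linear)

lemmas ladj_linear_simps [simp] = linear_add[OF linear_ladj] linear_diff[OF linear_ladj]
  linear_neg[OF linear_ladj] linear_cmul[OF linear_ladj] linear_0[OF linear_ladj]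

lemma ladj_mult [simp]: "ladj (A ** B) = ladj B ** ladj A"
  by (rule ladj_unique) (simp add: matrix_vector_mul_assoc[symmetric] lorentz_ladj)

lemma ladj_mat_1 [simp]: "ladj (mat 1) = mat 1"
  by (rule ladj_unique) simp

lemma ladj_outer [simp]: "ladj (outer x y) = outer y x"
  by (rule ladj_unique) (simp add: bil_simps lorentz_commute)

lemma mult_outer: "A ** outer x y = outer (A *v x) y"
  by (simp add: matrix_eq matrix_vector_mul_assoc[symmetric] bil_simps)

lemma outer_mult: "outer x y ** A = outer x (ladj A *v y)"
  by (simp add: matrix_eq matrix_vector_mul_assoc[symmetric] lorentz_ladj)

lemma trace_outer [simp]: "trace (outer x y) = lorentz x y"
  by (simp add: trace_def outer_def lorentz_alt algebra_simps)

lemma linear_trace: "linear (trace :: real^'a::finite^'a \<Rightarrow> real)"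
  by (simp add: linear_iff trace_def sum.distrib sum_distrib_left)

lemmas trace_simps = linear_add[OF linear_trace] linear_diff[OF linear_trace]
  linear_neg[OF linear_trace] linear_cmul[OF linear_trace] linear_0[OF linear_trace]

lemma det_ladj: "det (ladj A) = det A"
proof -
  define E :: "'a lorentz_mat" where "E = (\<chi> i k. if i = k then sgl i else 0)"
  have "ladj A = E ** transpose A ** E"
    by (simp add: vec_eq_iff ladj_def E_def matrix_matrix_mult_def transpose_def
        mult_delta_left mult_delta_right)
  moreover have "E ** E = mat 1"
    by (simp add: vec_eq_iff E_def matrix_matrix_mult_def mat_def mult_delta_left)
  then have "det E * det E = 1" by (metis det_I det_mul)
  ultimately show ?thesis
    by (simp add: det_mul det_transpose algebra_simps)
qed

lemma so_lorentz_iff: "A \<in> so_lorentz \<longleftrightarrow> ladj A = - A"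
proof
  assume "A \<in> so_lorentz"
  then have "lorentz (A *v x) y = lorentz x ((- A) *v y)" for x y
    unfolding so_lorentz_def by (simp add: bil_simps) (metis add_eq_0_iff2)
  then show "ladj A = - A" by (rule ladj_unique)
next
  assume "ladj A = - A"
  then show "A \<in> so_lorentz" by (simp add: so_lorentz_def lorentz_ladj bil_simps)
qed

lemma lorentz_so: "ladj A = - A \<Longrightarrow> lorentz (A *v x) y = - lorentz x (A *v y)"
  by (simp add: lorentz_ladj bil_simps)

lemma preserves_lorentz_iff:
  "(\<forall>x y. lorentz (A *v x) (A *v y) = lorentz x y) \<longleftrightarrow> ladj A ** A = mat 1"
proof
  assume *: "\<forall>x y. lorentz (A *v x) (A *v y) = lorentz x y"
  have "(ladj A ** A) *v y = y" for y
    by (rule lorentz_eqI)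
       (metis * lorentz_commute lorentz_ladj matrix_vector_mul_assoc)
  then show "ladj A ** A = mat 1" by (simp add: matrix_eq)
next
  assume "ladj A ** A = mat 1"
  then show "\<forall>x y. lorentz (A *v x) (A *v y) = lorentz x y"
    by (simp add: lorentz_ladj matrix_vector_mul_assoc)
qed

lemma SO0_iff: "A \<in> SO0 \<longleftrightarrow> ladj A ** A = mat 1 \<and> det A = 1 \<and> A $ None $ None > 0"
  by (simp add: SO0_def preserves_lorentz_iff)

lemma SO0_ladj:
  assumes "A \<in> SO0"
  shows "ladj A ** A = mat 1" "A ** ladj A = mat 1" "matrix_inv A = ladj A"
    and "ladj A *v (A *v x) = x" "A *v (ladj A *v x) = x"
    and "ladj A ** (A ** B) = B" "A ** (ladj A ** B) = B"
proof -
  show 1: "ladj A ** A = mat 1" using assms by (simp add: SO0_iff)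
  then show 2: "A ** ladj A = mat 1" using matrix_left_right_inverse by blast
  have "A ** matrix_inv A = mat 1"
    unfolding matrix_inv_def by (rule someI2[of _ "ladj A"]) (use 1 2 in auto)
  then have "ladj A ** (A ** matrix_inv A) = ladj A" by simp
  then show "matrix_inv A = ladj A" by (simp add: matrix_mul_assoc 1)
  show "ladj A *v (A *v x) = x" "A *v (ladj A *v x) = x"
    by (simp_all add: matrix_vector_mul_assoc 1 2)
  show "ladj A ** (A ** B) = B" "A ** (ladj A ** B) = B"
    by (simp_all add: matrix_mul_assoc 1 2)
qed

lemma SO0_lorentz: "A \<in> SO0 \<Longrightarrow> lorentz (A *v x) (A *v y) = lorentz x y"
  by (simp add: SO0_def)

section \<open>Curves in the Lorentz group\<close>

text \<open>Only the isometry condition is imposed, because products preserve it for all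
  \<open>t\<close>. Determinant and time orientation are recovered near \<open>0\<close> by
  continuity in \<open>SO0_curve\<close>.\<close>

definition lorentz_curve :: "'n::finite lorentz_mat \<Rightarrow> (real \<Rightarrow> 'n lorentz_mat) \<Rightarrow> bool" where
  "lorentz_curve X \<gamma> \<longleftrightarrow> smooth_on UNIV \<gamma> \<and> \<gamma> 0 = mat 1 \<and>
     (\<gamma> has_vector_derivative X) (at 0) \<and> (\<forall>t. ladj (\<gamma> t) ** \<gamma> t = mat 1)"

definition wedge :: "'n::finite lorentz_vec \<Rightarrow> 'n lorentz_vec \<Rightarrow> 'n lorentz_mat" where
  "wedge a b = outer a b - outer b a"

lemma ladj_wedge: "ladj (wedge a b) = - wedge a b"
  by (simp add: wedge_def)

lemma lorentz_curve_0: "lorentz_curve 0 (\<lambda>t. mat 1)"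
  by (simp add: lorentz_curve_def smooth_on_const)

lemma lorentz_curve_add:
  assumes "lorentz_curve X \<gamma>" "lorentz_curve Y \<delta>"
  shows "lorentz_curve (X + Y) (\<lambda>t. \<gamma> t ** \<delta> t)"
proof -
  have "smooth_on UNIV (\<lambda>t. \<gamma> t ** \<delta> t)"
    by (rule smooth_on_bilinear[OF open_UNIV bounded_bilinear_mm])
       (use assms in \<open>auto simp: lorentz_curve_def\<close>)
  moreover have "((\<lambda>t. \<gamma> t ** \<delta> t) has_vector_derivative X + Y) (at 0)"
    using mm.has_vector_derivative[of \<gamma> X 0 UNIV \<delta> Y] assms
    by (simp add: lorentz_curve_def add.commute)
  moreover have "ladj (\<gamma> t ** \<delta> t) ** (\<gamma> t ** \<delta> t) = mat 1" for t
  proof -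
    have "ladj (\<gamma> t ** \<delta> t) ** (\<gamma> t ** \<delta> t) = ladj (\<delta> t) ** (ladj (\<gamma> t) ** \<gamma> t) ** \<delta> t"
      by (simp add: matrix_mul_assoc)
    then show ?thesis using assms by (simp add: lorentz_curve_def)
  qed
  ultimately show ?thesis using assms by (simp add: lorentz_curve_def)
qed

text \<open>For \<open>a\<close> null and orthogonal to \<open>b\<close> the matrix \<open>N = wedge a b\<close> has \<open>N\<^sup>3 = 0\<close>, so that its
  one-parameter group is a polynomial in \<open>t\<close>. These null rotations span the Lie algebra.\<close>

lemma lorentz_curve_null:
  assumes "lorentz a a = 0" "lorentz a b = 0"
  shows "lorentz_curve (wedge a b)
    (\<lambda>t. mat 1 + t *\<^sub>R wedge a b + (t * t) *\<^sub>R (- (lorentz b b / 2) *\<^sub>R outer a a))" (is "lorentz_curve _ ?\<gamma>")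
proof -
  let ?N = "wedge a b" and ?M = "- (lorentz b b / 2) *\<^sub>R outer a a"
  have NN: "?N ** ?N = ?M + ?M"
    unfolding scaleR_add_left[symmetric] using assms lorentz_commute[of b a]
    by (simp add: wedge_def bil_simps mult_outer outer_mult)
  have NM: "?N ** ?M = 0" "?M ** ?N = 0" "?M ** ?M = 0"
    using assms lorentz_commute[of b a]
    by (simp_all add: wedge_def bil_simps mult_outer outer_mult)
  have s: "smooth_on UNIV (\<lambda>t. t *\<^sub>R Y)" "smooth_on UNIV (\<lambda>t. (t * t) *\<^sub>R Y)" for Y :: "'a lorentz_mat"
    by (rule smooth_on_bilinear[OF open_UNIV bounded_bilinear_scaleR];
        simp add: smooth_on_const smooth_on_id smooth_on_bilinear[OF open_UNIV bounded_bilinear_mult])+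
  have "smooth_on UNIV ?\<gamma>"
    by (rule smooth_on_add[OF open_UNIV smooth_on_add[OF open_UNIV smooth_on_const s(1)] s(2)])
  moreover have "(?\<gamma> has_vector_derivative ?N) (at 0)"
    by (auto intro!: derivative_eq_intros simp: has_vector_derivative_def)
  moreover have "ladj (?\<gamma> t) ** ?\<gamma> t = mat 1" for t
  proof -
    have "ladj (?\<gamma> t) = mat 1 - t *\<^sub>R ?N + (t * t) *\<^sub>R ?M"
      by (simp add: ladj_wedge)
    moreover have "(mat 1 - t *\<^sub>R N + s *\<^sub>R M) ** (mat 1 + t *\<^sub>R N + s *\<^sub>R M) =
        mat 1 + s *\<^sub>R (M + M) - (t * t) *\<^sub>R (N ** N) + (s * t) *\<^sub>R (M ** N - N ** M) + (s * s) *\<^sub>R (M ** M)"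
      for s and N M :: "'a lorentz_mat"
      by (simp add: bil_simps scaleR_diff_right scaleR_add_right mult.commute)
    ultimately have "ladj (?\<gamma> t) ** ?\<gamma> t = mat 1 + (t * t) *\<^sub>R (?M + ?M) - (t * t) *\<^sub>R (?N ** ?N)
        + (t * t * t) *\<^sub>R (?M ** ?N - ?N ** ?M) + (t * t * (t * t)) *\<^sub>R (?M ** ?M)"
      by metis
    then show ?thesis unfolding NN NM by simp
  qed
  ultimately show ?thesis by (simp add: lorentz_curve_def)
qed

lemma lorentz_axis_axis: "lorentz (axis i 1) (axis k 1) = (if i = k then sgl i else 0)"
  by (subst lorentz_axis) (simp add: axis_def)

text \<open>For distinct spatial \<open>i\<close> and \<open>k\<close>, the vectors
  \<open>e\<^sub>0 + e\<^sub>i\<close> and \<open>e\<^sub>0 - e\<^sub>i\<close> are null and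
  orthogonal to \<open>e\<^sub>k\<close>. Half the sum of their wedges with \<open>e\<^sub>k\<close>
  is the wedge of \<open>e\<^sub>0\<close> and \<open>e\<^sub>k\<close>, half the difference that of
  \<open>e\<^sub>i\<close> and \<open>e\<^sub>k\<close>.\<close>

lemma lorentz_curve_axis_wedge:
  fixes i k :: "('n::finite + 'n) option"
  shows "\<exists>\<gamma>. lorentz_curve (c *\<^sub>R wedge (axis i 1) (axis k 1)) \<gamma>"
proof -
  let ?e = "\<lambda>i :: ('n + 'n) option. axis i (1::real)"
  note axx = lorentz_axis_axis
  have *: "\<exists>\<gamma>. lorentz_curve (c *\<^sub>R wedge (?e None) (?e k)) \<gamma>"
    "\<exists>\<gamma>. lorentz_curve (c *\<^sub>R wedge (?e i) (?e k)) \<gamma>"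
    if "i \<noteq> k" "i \<noteq> None" "k \<noteq> None" for i k c
  proof -
    have n: "\<exists>\<gamma>. lorentz_curve (wedge (?e None + s *\<^sub>R ?e i) (d *\<^sub>R ?e k)) \<gamma>" if "s * s = 1" for s d
    proof (rule exI, rule lorentz_curve_null)
      show "lorentz (?e None + s *\<^sub>R ?e i) (?e None + s *\<^sub>R ?e i) = 0"
        using \<open>i \<noteq> None\<close> that by (cases i) (auto simp: bil_simps axx)
      show "lorentz (?e None + s *\<^sub>R ?e i) (d *\<^sub>R ?e k) = 0"
        using \<open>i \<noteq> k\<close> \<open>k \<noteq> None\<close> by (auto simp: bil_simps axx)
    qed
    have "c *\<^sub>R wedge (?e None) (?e k) =
        wedge (?e None + 1 *\<^sub>R ?e i) ((c/2) *\<^sub>R ?e k) + wedge (?e None + (-1) *\<^sub>R ?e i) ((c/2) *\<^sub>R ?e k)"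
      "c *\<^sub>R wedge (?e i) (?e k) =
        wedge (?e None + 1 *\<^sub>R ?e i) ((c/2) *\<^sub>R ?e k) + wedge (?e None + (-1) *\<^sub>R ?e i) ((-c/2) *\<^sub>R ?e k)"
      by (simp_all add: wedge_def outer_def vec_eq_iff field_simps)
    then show "\<exists>\<gamma>. lorentz_curve (c *\<^sub>R wedge (?e None) (?e k)) \<gamma>"
      "\<exists>\<gamma>. lorentz_curve (c *\<^sub>R wedge (?e i) (?e k)) \<gamma>"
      using n[of 1 "c/2"] n[of "-1" "c/2"] n[of "-1" "-c/2"] lorentz_curve_add by fastforce+
  qed
  \<comment> \<open>Two spatial indices exist even when \<open>'n\<close> has one element: one from
    each summand of \<open>'n + 'n\<close>.\<close>
  have ex: "\<exists>i. i \<noteq> k \<and> i \<noteq> None" for k :: "('n + 'n) option"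
  proof (cases "k = Some (Inl undefined)")
    case True
    then show ?thesis by (intro exI[of _ "Some (Inr undefined)"]) simp
  qed (intro exI[of _ "Some (Inl undefined)"], simp)
  have eq: "\<exists>\<gamma>. lorentz_curve (c *\<^sub>R wedge (?e i) (?e i)) \<gamma>" for i
    using lorentz_curve_0 by (auto simp: wedge_def)
  have sw: "c *\<^sub>R wedge (?e i) (?e k) = (- c) *\<^sub>R wedge (?e k) (?e i)"
    by (simp add: wedge_def algebra_simps)
  show ?thesis
  proof (cases "i = k")
    case False
    then show ?thesis using *[of i k c] *(1)[of _ k c] *(1)[of _ i "-c"] ex[of k] ex[of i] sw
      by (cases "i = None"; cases "k = None") auto
  qed (use eq in blast)
qed

lemma lorentz_curve_sum:
  assumes "finite S" "\<And>i. i \<in> S \<Longrightarrow> \<exists>\<gamma>. lorentz_curve (X i) \<gamma>"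
  shows "\<exists>\<gamma>. lorentz_curve (sum X S) \<gamma>"
  using assms
proof (induction S rule: finite_induct)
  case empty
  then show ?case using lorentz_curve_0 by auto
next
  case (insert i S)
  obtain \<gamma> where "lorentz_curve (X i) \<gamma>" using insert.prems by blast
  moreover obtain \<delta> where "lorentz_curve (sum X S) \<delta>" using insert.IH insert.prems by blast
  ultimately have "lorentz_curve (X i + sum X S) (\<lambda>t. \<gamma> t ** \<delta> t)" by (rule lorentz_curve_add)
  then show ?case using insert.hyps by auto
qed

text \<open>\<open>outer (axis k 1) (axis i 1)\<close> is \<open>sgl i\<close> times a matrix unit,
  whence the sign. Averaging \<open>X\<close> with \<open>- ladj X\<close> turns the matrix units
  into wedges and brings in the factor 1/2.\<close>

lemma so_lorentz_expansion:
  fixes X :: "'n::finite lorentz_mat"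
  assumes "ladj X = - X"
  shows "X = (\<Sum>i\<in>UNIV. \<Sum>k\<in>UNIV. (sgl i * X $ k $ i / 2) *\<^sub>R wedge (axis k 1) (axis i 1))"
proof -
  have *: "X = (\<Sum>i\<in>UNIV. \<Sum>k\<in>UNIV. (sgl i * X $ k $ i) *\<^sub>R outer (axis k 1) (axis i 1))"
    (is "X = ?R")
  proof -
    have "?R $ r $ c = X $ r $ c" for r c
    proof -
      have "?R $ r $ c = (\<Sum>i\<in>UNIV. \<Sum>k\<in>UNIV. if k = r then (if i = c then X $ r $ c else 0) else 0)"
        unfolding sum_component by (intro sum.cong) (auto simp: outer_def axis_def)
      then show ?thesis by simp
    qed
    then show ?thesis by (simp add: vec_eq_iff)
  qed
  have "ladj X = (\<Sum>i\<in>UNIV. \<Sum>k\<in>UNIV. (sgl i * X $ k $ i) *\<^sub>R outer (axis i 1) (axis k 1))"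
    using arg_cong[OF *, of ladj] by (simp add: linear_sum[OF linear_ladj])
  then have "X - ladj X = (\<Sum>i\<in>UNIV. \<Sum>k\<in>UNIV. (sgl i * X $ k $ i) *\<^sub>R wedge (axis k 1) (axis i 1))"
    unfolding wedge_def scaleR_diff_right sum_subtractf using * by simp
  then have "(1/2) *\<^sub>R (X - ladj X) =
      (\<Sum>i\<in>UNIV. \<Sum>k\<in>UNIV. (sgl i * X $ k $ i / 2) *\<^sub>R wedge (axis k 1) (axis i 1))"
    by (simp only: scaleR_sum_right scaleR_scaleR) simp
  moreover have "(1/2) *\<^sub>R (X - ladj X) = X"
    using assms by (simp add: scaleR_2[symmetric])
  ultimately show ?thesis by simp
qed

lemma so_lorentz_curve:
  assumes "ladj X = - X"
  shows "\<exists>\<gamma>. lorentz_curve X \<gamma>"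
  by (subst so_lorentz_expansion[OF assms])
     (intro lorentz_curve_sum lorentz_curve_axis_wedge; simp)

lemma isCont_lorentz_curve: "lorentz_curve X \<gamma> \<Longrightarrow> isCont \<gamma> 0"
  unfolding lorentz_curve_def has_vector_derivative_def using has_derivative_continuous by blast

lemma eventually_interval:
  assumes "eventually P (at 0)" "P (0::real)"
  shows "\<exists>e>0. \<forall>t\<in>{-e<..<e}. P t"
proof -
  obtain d where d: "d > 0" "\<And>x. x \<noteq> 0 \<Longrightarrow> \<bar>x\<bar> < d \<Longrightarrow> P x"
    using assms(1) by (auto simp: eventually_at dist_real_def)
  have "P t" if "t \<in> {-d<..<d}" for t
    using d(2)[of t] assms(2) that by (cases "t = 0") auto
  with d(1) show ?thesis by blast
qed

text \<open>An isometry has determinant 1 or -1, so positivity near \<open>0\<close> already forces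
  1, and the time orientation persists by continuity as well. The curve multiplies \<open>A\<close>
  from the left so as to start at an arbitrary group element.\<close>

lemma SO0_curve:
  assumes X: "ladj X = - X" and A: "A \<in> SO0"
  obtains \<gamma> e where "e > 0" "lorentz_curve X \<gamma>" "\<And>t. t \<in> {-e<..<e} \<Longrightarrow> \<gamma> t ** A \<in> SO0"
proof -
  obtain \<gamma> where \<gamma>: "lorentz_curve X \<gamma>" using so_lorentz_curve[OF X] by blast
  note c = isCont_lorentz_curve[OF \<gamma>]
  have "isCont (\<lambda>t. det (\<gamma> t)) 0" using c unfolding det_def by (intro continuous_intros)
  moreover have "det (\<gamma> 0) > 0" using \<gamma> by (simp add: lorentz_curve_def)
  ultimately have d: "eventually (\<lambda>t. det (\<gamma> t) > 0) (at 0)"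
    by (auto simp: isCont_def intro: order_tendstoD)
  have "isCont (\<lambda>t. (\<gamma> t ** A) $ None $ None) 0"
    using c by (intro continuous_intros mm.isCont)
  moreover have "(\<gamma> 0 ** A) $ None $ None > 0" using \<gamma> A by (simp add: lorentz_curve_def SO0_iff)
  ultimately have "eventually (\<lambda>t. (\<gamma> t ** A) $ None $ None > 0) (at 0)"
    by (auto simp: isCont_def intro: order_tendstoD)
  with d have "eventually (\<lambda>t. det (\<gamma> t) > 0 \<and> (\<gamma> t ** A) $ None $ None > 0) (at 0)"
    by eventually_elim simp
  then obtain e where e: "e > 0" "\<forall>t\<in>{-e<..<e}. det (\<gamma> t) > 0 \<and> (\<gamma> t ** A) $ None $ None > 0"
    using eventually_interval[of "\<lambda>t. det (\<gamma> t) > 0 \<and> (\<gamma> t ** A) $ None $ None > 0"]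
      \<open>det (\<gamma> 0) > 0\<close> \<open>(\<gamma> 0 ** A) $ None $ None > 0\<close> by blast
  have "\<gamma> t ** A \<in> SO0" if "t \<in> {-e<..<e}" for t
  proof -
    have g: "ladj (\<gamma> t) ** \<gamma> t = mat 1" using \<gamma> by (simp add: lorentz_curve_def)
    then have "det (\<gamma> t) * det (\<gamma> t) = 1" by (metis det_I det_mul det_ladj)
    then have "det (\<gamma> t) = 1" using e(2) that square_eq_1_iff[of "det (\<gamma> t)"] by force
    moreover have "ladj (\<gamma> t ** A) ** (\<gamma> t ** A) = ladj A ** (ladj (\<gamma> t) ** \<gamma> t) ** A"
      by (simp add: matrix_mul_assoc)
    ultimately show ?thesis using g e(2) that A by (simp add: SO0_iff det_mul)
  qed
  with e(1) \<gamma> that show ?thesis by blast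
qed

lemma mat_1_SO0: "mat 1 \<in> SO0"
  by (simp add: SO0_iff) (simp add: mat_def)

lemma tangent_hyperbolic:
  assumes x: "x \<in> hyperbolic_space"
  shows "y \<in> tangent_space hyperbolic_space x \<longleftrightarrow> lorentz x y = 0"
proof
  assume "y \<in> tangent_space hyperbolic_space x"
  then obtain \<gamma> where \<gamma>: "curve_through hyperbolic_space x y \<gamma>" by (auto simp: tangent_space_def)
  have "((\<lambda>q. lorentz q q) has_derivative (\<lambda>h. lorentz x h + lorentz h x)) (at x)"
    by (rule lor.FDERIV[OF has_derivative_ident has_derivative_ident])
  from curve_derivative_unique[OF \<gamma> open_UNIV _ _ this, of "\<lambda>q. - 1"]
  have "(((\<lambda>q. - 1) \<circ> \<gamma>) has_vector_derivative lorentz x y + lorentz y x) (at 0)"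
    by (simp add: hyperbolic_space_def)
  moreover have "(((\<lambda>q. - 1) \<circ> \<gamma>) has_vector_derivative (0::real)) (at 0)"
    by (simp add: o_def)
  ultimately show "lorentz x y = 0"
    using vector_derivative_unique_at lorentz_commute[of x y] by fastforce
next
  assume y: "lorentz x y = 0"
  \<comment> \<open>\<open>wedge x y\<close> maps \<open>x\<close> to \<open>y\<close>, because
    \<open>lorentz x x = -1\<close> and \<open>lorentz y x = 0\<close>.\<close>
  have l: "ladj (wedge x y) = - wedge x y" by (rule ladj_wedge)
  obtain \<gamma> where \<gamma>: "lorentz_curve (wedge x y) \<gamma>"
    using so_lorentz_curve[OF l] by blast
  have c: "isCont (\<lambda>t. (\<gamma> t *v x) $ None) 0"
    using isCont_lorentz_curve[OF \<gamma>] by (intro continuous_intros mv.isCont)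
  have g0: "(\<gamma> 0 *v x) $ None > 0" using \<gamma> x by (simp add: lorentz_curve_def hyperbolic_space_def)
  have "eventually (\<lambda>t. (\<gamma> t *v x) $ None > 0) (at 0)"
    using c g0 by (auto simp: isCont_def intro: order_tendstoD)
  then obtain e where e: "e > 0" "\<forall>t\<in>{-e<..<e}. (\<gamma> t *v x) $ None > 0"
    using eventually_interval[of "\<lambda>t. (\<gamma> t *v x) $ None > 0"] g0 by blast
  have "smooth_on UNIV (\<lambda>t. \<gamma> t *v x)"
    by (rule smooth_on_bilinear[OF open_UNIV bounded_bilinear_mv _ smooth_on_const])
       (use \<gamma> in \<open>simp add: lorentz_curve_def\<close>)
  then have "smooth_on {-e<..<e} (\<lambda>t. \<gamma> t *v x)" by (rule smooth_on_subset[rotated]) simp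
  moreover have "(\<lambda>t. \<gamma> t *v x) ` {-e<..<e} \<subseteq> hyperbolic_space"
    using e(2) \<gamma> x by (auto simp: hyperbolic_space_def lorentz_curve_def preserves_lorentz_iff[symmetric])
  moreover have "((\<lambda>t. \<gamma> t *v x) has_vector_derivative y) (at 0)"
    using mv.has_vector_derivative[of \<gamma> "wedge x y" 0 UNIV "\<lambda>t. x" 0] \<gamma> x y lorentz_commute[of y x]
    by (simp add: lorentz_curve_def wedge_def bil_simps hyperbolic_space_def)
  ultimately have "curve_through hyperbolic_space x y (\<lambda>t. \<gamma> t *v x)"
    using e(1) \<gamma> by (auto simp: curve_through_def lorentz_curve_def)
  then show "y \<in> tangent_space hyperbolic_space x" by (auto simp: tangent_space_def)
qed

section \<open>The twistor space as an orbit of the Lorentz group\<close>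

definition conj_act :: "'n::finite lorentz_mat \<Rightarrow> 'n twistor_point \<Rightarrow> 'n twistor_point" where
  "conj_act A p = (A *v fst p, A ** snd p ** ladj A)"

text \<open>With \<open>ladj A\<close> in place of the inverse the action is polynomial in
  \<open>A\<close>, hence extends off the group and can be differentiated in the ambient
  space.\<close>

lemma twistor_act_SO0: "A \<in> SO0 \<Longrightarrow> twistor_act A p = conj_act A p"
  by (simp add: twistor_act_def conj_act_def SO0_ladj split: prod.split)

lemma matrix_eq_axis:
  fixes A B :: "real^'n::finite^'m::finite"
  assumes "\<And>k. A *v axis k 1 = B *v axis k 1"
  shows "A = B"
  using assms by (simp add: matrix_vector_mult_basis column_def vec_eq_iff)

lemma j0'_axis:
  "j0' *v axis None 1 = 0"
  "j0' *v axis (Some (Inl a)) 1 = axis (Some (Inr a)) 1"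
  "j0' *v axis (Some (Inr a)) 1 = - axis (Some (Inl a)) 1"
  unfolding matrix_vector_mult_basis
  by (auto simp: column_def vec_eq_iff j0'_def block_def j0_def axis_def
      split: option.split sum.split)

lemma SO0_base_in_twistor:
  assumes A: "A \<in> SO0"
  shows "conj_act A twistor_base \<in> twistor_space"
proof -
  define x where "x = A *v axis None 1"
  define v where "v i = A *v axis (Some i) 1" for i
  define j where "j = A ** j0' ** ladj A"
  have x: "x \<in> hyperbolic_space"
    using A by (simp add: x_def hyperbolic_space_def SO0_lorentz lorentz_axis_axis)
      (simp add: matrix_vector_mult_basis column_def SO0_iff)
  have j: "j *v (A *v y) = A *v (j0' *v y)" for y
    using A by (simp add: j_def matrix_vector_mul_assoc[symmetric] SO0_ladj)
  \<comment> \<open>The columns of \<open>A\<close> are the point and a frame there, so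
    \<open>A \<in> SO0\<close> provides orthonormality and orientation.\<close>
  have "(\<chi> r c. (case c of None \<Rightarrow> x | Some i \<Rightarrow> v i) $ r) = A"
    by (simp add: vec_eq_iff x_def v_def matrix_vector_mult_basis column_def split: option.split)
  then have "oriented_orthonormal_basis x v"
    using A by (simp add: oriented_orthonormal_basis_def tangent_hyperbolic[OF x])
      (simp add: x_def v_def SO0_lorentz lorentz_axis_axis SO0_iff)
  then show ?thesis
    using x j[of "axis None 1"] j[of "axis (Some (Inl _)) 1"] j[of "axis (Some (Inr _)) 1"]
    unfolding twistor_space_def conj_act_def twistor_base_def
    by (auto simp: x_def[symmetric] j_def[symmetric] v_def[symmetric] j0'_axis bil_simps intro!: exI[of _ v])
qed

text \<open>Transitivity: the point and its frame become the columns of \<open>A\<close>.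
  Orthonormality makes \<open>A\<close> an isometry, orientation fixes the sign of the determinant,
  and the positive time component of \<open>x\<close> is the time orientation of
  \<open>A\<close>.\<close>

lemma twistor_SO0_base:
  assumes "p \<in> twistor_space"
  obtains A where "A \<in> SO0" "p = conj_act A twistor_base"
proof -
  obtain x j v where p: "p = (x, j)" and x: "x \<in> hyperbolic_space" and jx: "j *v x = 0"
    and v: "oriented_orthonormal_basis x v"
    and jv: "\<And>i. j *v v (Inl i) = v (Inr i)" "\<And>i. j *v v (Inr i) = - v (Inl i)"
    using assms unfolding twistor_space_def by blast
  define A where "A = (\<chi> r c. (case c of None \<Rightarrow> x | Some i \<Rightarrow> v i) $ r)"
  have A: "A *v axis None 1 = x" "A *v axis (Some i) 1 = v i" for i
    by (simp_all add: A_def matrix_vector_mult_basis column_def vec_eq_iff)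
  have vv: "lorentz (v i) (v k) = (if i = k then 1 else 0)" "lorentz x (v i) = 0" "lorentz (v i) x = 0"
    "lorentz x x = - 1" for i k
    using v x lorentz_commute[of x "v i"]
    by (auto simp: oriented_orthonormal_basis_def tangent_hyperbolic[OF x])
       (auto simp: hyperbolic_space_def)
  have "lorentz (A *v axis i 1) (A *v axis k 1) = (if i = k then sgl i else 0)" for i k
    by (cases i; cases k) (simp_all add: A vv)
  then have "((ladj A ** A) *v axis k 1) $ i = (mat 1 *v axis k 1) $ i" for i k
    by (metis (no_types, lifting) lorentz_axis lorentz_axis_axis lorentz_commute lorentz_ladj
        matrix_vector_mul_assoc matrix_vector_mul_lid sgl_sq(2))
  then have AA: "ladj A ** A = mat 1"
    by (intro matrix_eq_axis) (simp add: vec_eq_iff)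
  then have "det A * det A = 1" by (metis det_I det_mul det_ladj)
  moreover have "det A > 0" using v by (simp add: oriented_orthonormal_basis_def A_def)
  ultimately have "det A = 1" using square_eq_1_iff[of "det A"] by force
  moreover have "A $ None $ None > 0" using x by (simp add: A_def hyperbolic_space_def)
  ultimately have S: "A \<in> SO0" using AA by (simp add: SO0_iff)
  have "j ** A = A ** j0'"
  proof (rule matrix_eq_axis)
    fix k show "j ** A *v axis k 1 = A ** j0' *v axis k 1"
    proof (cases k)
      case None
      then show ?thesis by (simp add: matrix_vector_mul_assoc[symmetric] A j0'_axis jx)
    next
      case (Some i)
      then show ?thesis
        by (cases i) (simp_all add: matrix_vector_mul_assoc[symmetric] A j0'_axis jv bil_simps)
    qed
  qed
  then have "j = A ** j0' ** ladj A"
    by (metis S SO0_ladj(2) matrix_mul_assoc matrix_mul_rid)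
  then show ?thesis using that[OF S] by (simp add: p conj_act_def twistor_base_def A)
qed

section \<open>Tangent spaces of the twistor space\<close>

definition lvec :: "real \<Rightarrow> 'n::finite space_vec \<Rightarrow> 'n lorentz_vec" where
  "lvec a u = (\<chi> i. case i of None \<Rightarrow> a | Some k \<Rightarrow> u $ k)"

definition dyad :: "'n::finite space_vec \<Rightarrow> 'n space_vec \<Rightarrow> 'n space_mat" where
  "dyad u w = (\<chi> i k. u $ i * w $ k)"

lemma lvec_nth [simp]: "lvec a u $ None = a" "lvec a u $ Some k = u $ k"
  by (simp_all add: lvec_def)

lemma block_nth [simp]: "block a r u B $ None $ None = a" "block a r u B $ None $ Some k = r $ k"
  "block a r u B $ Some i $ None = u $ i" "block a r u B $ Some i $ Some k = B $ i $ k"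
  by (simp_all add: block_def)

lemma all_option: "(\<forall>i. P i) \<longleftrightarrow> P None \<and> (\<forall>k. P (Some k))"
  by (metis option.exhaust)

lemma lvec_eq_iff [simp]: "lvec a u = lvec b w \<longleftrightarrow> a = b \<and> u = w"
  by (simp add: vec_eq_iff all_option)

lemma block_eq_iff [simp]: "block a r u B = block a' r' u' B' \<longleftrightarrow> a = a' \<and> r = r' \<and> u = u' \<and> B = B'"
  by (auto simp: vec_eq_iff all_option)

lemma lvec_cases: obtains a u where "x = lvec a u"
proof
  show "x = lvec (x $ None) (\<chi> k. x $ Some k)" by (simp add: vec_eq_iff all_option)
qed

lemma block_cases: obtains a r u B where "A = block a r u B"
proof
  show "A = block (A $ None $ None) (\<chi> k. A $ None $ Some k) (\<chi> i. A $ Some i $ None)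
      (\<chi> i k. A $ Some i $ Some k)"
    by (simp add: vec_eq_iff all_option)
qed

lemma lvec_arith:
  "lvec a u + lvec b w = lvec (a + b) (u + w)" "lvec a u - lvec b w = lvec (a - b) (u - w)"
  "- lvec a u = lvec (- a) (- u)" "c *\<^sub>R lvec a u = lvec (c * a) (c *\<^sub>R u)" "0 = lvec 0 0"
  by (simp_all add: vec_eq_iff all_option)

lemma block_arith:
  "block a r u B + block a' r' u' B' = block (a + a') (r + r') (u + u') (B + B')"
  "block a r u B - block a' r' u' B' = block (a - a') (r - r') (u - u') (B - B')"
  "- block a r u B = block (- a) (- r) (- u) (- B)"
  "c *\<^sub>R block a r u B = block (c * a) (c *\<^sub>R r) (c *\<^sub>R u) (c *\<^sub>R B)"
  "0 = block 0 0 0 0"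
  by (simp_all add: vec_eq_iff all_option)

lemma block_lvec: "block a r u B *v lvec b w = lvec (a * b + r \<bullet> w) (b *\<^sub>R u + B *v w)"
  by (simp add: vec_eq_iff all_option matrix_vector_mult_def sum_option inner_vec_def algebra_simps)

lemma block_mult: "block a r u B ** block a' r' u' B' =
    block (a * a' + r \<bullet> u') (a *\<^sub>R r' + transpose B' *v r) (a' *\<^sub>R u + B *v u') (dyad u r' + B ** B')"
  by (simp add: vec_eq_iff all_option matrix_vector_mult_def matrix_matrix_mult_def sum_option
      inner_vec_def dyad_def transpose_def algebra_simps)

lemma outer_lvec: "outer (lvec a u) (lvec b w) = block (- (a * b)) (a *\<^sub>R w) (- (b *\<^sub>R u)) (dyad u w)"
  by (simp add: vec_eq_iff all_option outer_def dyad_def algebra_simps)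

lemma ladj_block: "ladj (block a r u B) = block a (- u) (- r) (transpose B)"
  by (simp add: vec_eq_iff all_option ladj_def transpose_def)

lemma trace_block: "trace (block a r u B) = a + trace B"
  by (simp add: trace_def sum_option)

lemma lorentz_lvec: "lorentz (lvec a u) (lvec b w) = - (a * b) + u \<bullet> w"
  by (simp add: lorentz_def inner_vec_def)

lemma axis_None: "axis None 1 = lvec 1 0"
  by (simp add: vec_eq_iff all_option axis_def)

lemma bounded_bilinear_dyad: "bounded_bilinear dyad"
  by (rule bilinear_bounded) (simp_all add: dyad_def vec_eq_iff algebra_simps)

interpretation dyad: bounded_bilinear dyad by (rule bounded_bilinear_dyad)

lemmas dyad_simps = dyad.add_left dyad.add_right dyad.diff_left dyad.diff_right dyad.minus_left
  dyad.minus_right dyad.scaleR_left dyad.scaleR_right dyad.zero_left dyad.zero_right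

lemma mult_dyad: "A ** dyad u w = dyad (A *v u) w"
  by (simp add: vec_eq_iff dyad_def matrix_matrix_mult_def matrix_vector_mult_def sum_distrib_right mult.assoc)

lemma dyad_mult: "dyad u w ** A = dyad u (transpose A *v w)"
  by (simp add: vec_eq_iff dyad_def matrix_matrix_mult_def matrix_vector_mult_def transpose_def
      sum_distrib_left mult.assoc mult.commute mult.left_commute)

lemma trace_dyad [simp]: "trace (dyad u w) = u \<bullet> w"
  by (simp add: trace_def dyad_def inner_vec_def)

lemma transpose_dyad [simp]: "transpose (dyad u w) = dyad w u"
  by (simp add: vec_eq_iff dyad_def transpose_def mult.commute)

lemma linear_transpose: "linear (transpose :: real^'a^'b \<Rightarrow> _)"
  by (simp add: linear_iff transpose_def vec_eq_iff)

lemmas transpose_simps = linear_add[OF linear_transpose] linear_diff[OF linear_transpose]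
  linear_neg[OF linear_transpose] linear_cmul[OF linear_transpose] linear_0[OF linear_transpose]

lemma sum_UNIV_sum: "sum f UNIV = (\<Sum>a\<in>UNIV. f (Inl a)) + (\<Sum>b\<in>UNIV. f (Inr b))"
  for f :: "'a::finite + 'b::finite \<Rightarrow> real"
  using sum.Plus[of UNIV UNIV f] by (simp add: o_def)

lemma j0_sq: "j0 ** j0 = - mat 1"
proof -
  have "(j0 ** j0) $ i $ k = (- mat 1 :: 'a space_mat) $ i $ k" for i k
    by (cases i; cases k)
       (simp_all add: matrix_matrix_mult_def j0_def sum_UNIV_sum mat_def mult_delta_left)
  then show ?thesis by (simp add: vec_eq_iff)
qed

lemma transpose_j0: "transpose j0 = - j0"
  by (simp add: vec_eq_iff j0_def transpose_def split: sum.split)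

lemma j0_j0 [simp]: "j0 ** (j0 ** B) = - B" "j0 *v (j0 *v u) = - u"
  by (simp_all add: matrix_mul_assoc matrix_vector_mul_assoc j0_sq bil_simps)

lemma inner_transpose: "(A *v u) \<bullet> w = u \<bullet> (transpose A *v w)" for A :: "real^'a::finite^'a"
  by (simp add: dot_lmul_matrix[symmetric] transpose_matrix_vector inner_commute)

lemma inner_j0: "(j0 *v u) \<bullet> w = - (u \<bullet> (j0 *v w))"
  by (simp add: inner_transpose transpose_j0 bil_simps)

lemma j0'_block: "j0' = block 0 0 0 j0"
  by (simp add: j0'_def)

text \<open>The infinitesimal action: for \<open>ladj X = - X\<close> it is the velocity of
  \<open>p\<close> when moved by a curve of isometries with derivative \<open>X\<close>.\<close>

definition lin_act :: "'n::finite lorentz_mat \<Rightarrow> 'n twistor_point \<Rightarrow> 'n twistor_point" where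
  "lin_act X p = (X *v fst p, X ** snd p - snd p ** X)"

text \<open>The polarization of \<open>(x, j) \<mapsto> (lorentz x x, 2 j x, 2 (j\<^sup>2 + x x\<^sup>*))\<close>, which is constant on the
  twistor space.\<close>

definition tangency :: "'n::finite twistor_point \<Rightarrow> 'n twistor_point \<Rightarrow> real \<times> 'n lorentz_vec \<times> 'n lorentz_mat" where
  "tangency p v = (lorentz (fst p) (fst v), snd v *v fst p + snd p *v fst v,
     snd v ** snd p + snd p ** snd v + outer (fst v) (fst p) + outer (fst p) (fst v))"

lemma bounded_bilinear_tangency: "bounded_bilinear tangency"
  by (rule bilinear_bounded) (simp_all add: tangency_def bil_simps algebra_simps)

lemma tangency_commute: "tangency p v = tangency v p"
  by (simp add: tangency_def lorentz_commute add.commute add.left_commute)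

text \<open>The complement of \<open>u(n)\<close> in \<open>so(2n)\<close>, that is, the tangent
  space of the fibre \<open>SO(2n)/U(n)\<close>.\<close>

definition anticomm :: "'n::finite space_mat \<Rightarrow> bool" where
  "anticomm B \<longleftrightarrow> transpose B = - B \<and> B ** j0 = - (j0 ** B)"

abbreviation horvert :: "'n::finite space_vec \<Rightarrow> 'n space_mat \<Rightarrow> 'n twistor_point" where
  "horvert u B \<equiv> lin_act (block 0 u u B) twistor_base"

lemma horvert_eq:
  assumes "anticomm B"
  shows "horvert u B = (lvec 0 u, block 0 (- (j0 *v u)) (- (j0 *v u)) (- 2 *\<^sub>R (j0 ** B)))"
proof -
  have "- (j0 ** B) - j0 ** B = (- 2) *\<^sub>R (j0 ** B)"
    by (simp add: vec_eq_iff)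
  then show ?thesis using assms
    by (simp add: lin_act_def twistor_base_def axis_None j0'_block block_mult block_lvec block_arith
      transpose_j0 bil_simps dyad_simps anticomm_def)
qed

lemma block_so: "transpose B = - B \<Longrightarrow> ladj (block 0 u u B) = - block 0 u u B"
  by (simp add: ladj_block block_arith)

lemma point_base:
  "lorentz (fst (twistor_base :: 'n::finite twistor_point)) (fst twistor_base) = - 1"
  "snd (twistor_base :: 'n twistor_point) *v fst twistor_base = 0"
  "ladj (snd (twistor_base :: 'n twistor_point)) = - snd twistor_base"
  "snd (twistor_base :: 'n twistor_point) ** snd twistor_base = - mat 1 - outer (fst twistor_base) (fst twistor_base)"
proof -
  have "mat 1 = (block 1 0 0 (mat 1) :: 'n lorentz_mat)"
    by (simp add: vec_eq_iff all_option mat_def)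
  then show "lorentz (fst (twistor_base :: 'n twistor_point)) (fst twistor_base) = - 1"
    "snd (twistor_base :: 'n twistor_point) *v fst twistor_base = 0"
    "ladj (snd (twistor_base :: 'n twistor_point)) = - snd twistor_base"
    "snd (twistor_base :: 'n twistor_point) ** snd twistor_base =
      - mat 1 - outer (fst twistor_base) (fst twistor_base)"
    by (simp_all add: twistor_base_def axis_None j0'_block lorentz_lvec block_lvec ladj_block
        block_mult outer_lvec transpose_j0 j0_sq dyad_simps bil_simps block_arith(1-4))
       (simp_all add: lvec_arith(5))
qed

lemma conj_act_inverse: "A \<in> SO0 \<Longrightarrow> conj_act (ladj A) (conj_act A p) = p"
  by (simp add: conj_act_def SO0_ladj matrix_mul_assoc[symmetric])

lemma SO0_ladj_in: "A \<in> SO0 \<Longrightarrow> ladj A \<in> SO0"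
  by (simp add: SO0_iff det_ladj matrix_left_right_inverse[of "ladj A" A]) (simp add: ladj_def)

lemma linear_conj_act: "linear (conj_act A)"
  by (simp add: linear_iff conj_act_def bil_simps)

lemma tangency_conj:
  assumes "A \<in> SO0"
  shows "tangency (conj_act A p) (conj_act A v) =
    (fst (tangency p v), A *v fst (snd (tangency p v)), A ** snd (snd (tangency p v)) ** ladj A)"
  using assms by (simp add: tangency_def conj_act_def SO0_lorentz SO0_ladj bil_simps
    matrix_mul_assoc[symmetric] matrix_vector_mul_assoc[symmetric] mult_outer outer_mult)

lemma tangency_self:
  fixes p :: "'n::finite twistor_point"
  assumes "p \<in> twistor_space"
  shows "tangency p p = (- 1, 0, - 2 *\<^sub>R mat 1)"
proof -
  obtain A where A: "A \<in> SO0" "p = conj_act A twistor_base" using twistor_SO0_base[OF assms] .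
  have "tangency (twistor_base :: 'n twistor_point) twistor_base = (- 1, 0, - 2 *\<^sub>R mat 1)"
    unfolding tangency_def point_base by (simp add: vec_eq_iff)
  then show ?thesis using A(1) by (simp add: A(2) tangency_conj SO0_ladj bil_simps)
qed

lemma twistor_antisym:
  assumes "p \<in> twistor_space"
  shows "ladj (snd p) = - snd p"
proof -
  obtain A where A: "A \<in> SO0" "p = conj_act A twistor_base" using twistor_SO0_base[OF assms] .
  then show ?thesis by (simp add: conj_act_def point_base bil_simps matrix_mul_assoc)
qed

lemma bounded_linear_antisym: "bounded_linear (\<lambda>q::'n::finite twistor_point. ladj (snd q) + snd q)"
  unfolding linear_conv_bounded_linear[symmetric] by (simp add: linear_iff algebra_simps)

lemma tangent_imp_tangency:
  fixes p :: "'n::finite twistor_point"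
  assumes p: "p \<in> twistor_space" and v: "v \<in> tangent_space twistor_space p"
  shows "tangency p v = 0" "ladj (snd v) = - snd v"
proof -
  interpret bounded_bilinear tangency by (rule bounded_bilinear_tangency)
  have "differential twistor_space (\<lambda>q. tangency q q) p v = tangency p v + tangency v p"
    by (rule differential_eq[OF v open_UNIV _ _ FDERIV[OF has_derivative_ident has_derivative_ident]]) auto
  moreover have "differential twistor_space (\<lambda>q. tangency q q) p v = 0"
    by (rule differential_eq[OF v open_UNIV, of "\<lambda>q. (- 1, 0, - 2 *\<^sub>R mat 1)" _ "\<lambda>q. 0"])
       (simp_all add: tangency_self)
  ultimately have "2 *\<^sub>R tangency p v = 0" using tangency_commute[of v p] by (simp add: scaleR_2)
  then show "tangency p v = 0" by simp
  have "differential twistor_space (\<lambda>q. ladj (snd q) + snd q) p v = ladj (snd v) + snd v"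
    by (rule differential_eq[OF v open_UNIV _ _ bounded_linear_imp_has_derivative[OF bounded_linear_antisym]]) auto
  moreover have "differential twistor_space (\<lambda>q. ladj (snd q) + snd q) p v = 0"
    by (rule differential_eq[OF v open_UNIV, of "\<lambda>q. 0" _ "\<lambda>q. 0"])
       (simp_all add: twistor_antisym)
  ultimately show "ladj (snd v) = - snd v" by (metis add_eq_0_iff2)
qed

text \<open>Read block by block, the equations leave the spatial part \<open>u\<close> free, make
  the mixed row and column of \<open>snd v\<close> equal to \<open>- (j0 *v u)\<close>, and let the
  spatial block be any skew matrix anticommuting with \<open>j0\<close>.\<close>

lemma tangency_base_imp_horvert:
  assumes "tangency twistor_base v = 0" "ladj (snd v) = - snd v"
  obtains u B where "anticomm B" "v = horvert u B"
proof -
  obtain a u where x: "fst v = lvec a u" by (rule lvec_cases)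
  obtain b r w D where k: "snd v = block b r w D" by (rule block_cases)
  have a: "a = 0" and w: "w = - (j0 *v u)" and b: "b = 0"
    using assms(1) by (auto simp: tangency_def twistor_base_def axis_None j0'_block x k lorentz_lvec
      block_lvec lvec_arith zero_prod_def eq_neg_iff_add_eq_0)
  have r: "r = w" and D: "transpose D = - D"
    using assms(2) unfolding k ladj_block block_arith(3) block_eq_iff neg_equal_iff_equal by blast+
  have "snd v ** j0' + j0' ** snd v + outer (fst v) (lvec 1 0) + outer (lvec 1 0) (fst v) = block 0 0 0 0"
    using assms(1) by (simp add: tangency_def twistor_base_def axis_None zero_prod_def block_arith(5)[symmetric])
  then have Dj: "D ** j0 = - (j0 ** D)"
    by (simp add: x k j0'_block block_mult outer_lvec block_arith(1-4) dyad_simps eq_neg_iff_add_eq_0)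
  \<comment> \<open>Inverts \<open>D = - 2 *\<^sub>R (j0 ** B)\<close>; the 2 comes from the
    commutator of \<open>B\<close> with \<open>j0\<close>.\<close>
  define B where "B = (1/2) *\<^sub>R (j0 ** D)"
  have "anticomm B"
    by (simp add: anticomm_def B_def transpose_simps matrix_transpose_mul D transpose_j0 bil_simps Dj
        matrix_mul_assoc[symmetric])
  moreover have "v = horvert u B"
    by (simp add: horvert_eq[OF \<open>anticomm B\<close>] prod_eq_iff x k a b w r) (simp add: B_def bil_simps)
  ultimately show ?thesis by (rule that)
qed

lemma conj_act_mult: "conj_act (A ** B) p = conj_act A (conj_act B p)"
  by (simp add: conj_act_def matrix_mul_assoc matrix_vector_mul_assoc)

text \<open>The point is moved along a curve of isometries. With \<open>p\<close> written through
  \<open>A\<close>, the curve stays on the orbit because \<open>\<gamma> t ** A\<close> remains in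
  \<open>SO0\<close> for small \<open>t\<close>.\<close>

lemma lin_act_tangent:
  fixes p :: "'n::finite twistor_point"
  assumes X: "ladj X = - X" and p: "p \<in> twistor_space"
  shows "lin_act X p \<in> tangent_space twistor_space p"
proof -
  obtain A where A: "A \<in> SO0" "p = conj_act A twistor_base" using twistor_SO0_base[OF p] .
  obtain \<gamma> e where e: "e > 0" and \<gamma>: "lorentz_curve X \<gamma>" and g: "\<And>t. t \<in> {-e<..<e} \<Longrightarrow> \<gamma> t ** A \<in> SO0"
    using SO0_curve[OF X A(1)] by metis
  let ?c = "\<lambda>t. conj_act (\<gamma> t) p"
  have s: "smooth_on UNIV \<gamma>" using \<gamma> by (simp add: lorentz_curve_def)
  have d: "(\<gamma> has_vector_derivative X) (at 0)" and g0: "\<gamma> 0 = mat 1"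
    using \<gamma> by (simp_all add: lorentz_curve_def)
  have "smooth_on UNIV ?c"
    unfolding conj_act_def
    using smooth_on_bilinear[OF open_UNIV bounded_bilinear_mv s smooth_on_const[of UNIV "fst p"]]
      smooth_on_bilinear[OF open_UNIV bounded_bilinear_mm
        smooth_on_bilinear[OF open_UNIV bounded_bilinear_mm s smooth_on_const[of UNIV "snd p"]]
        smooth_on_linear[OF open_UNIV bounded_linear_ladj s]]
    by (rule smooth_on_Pair[OF open_UNIV])
  then have "smooth_on {-e<..<e} ?c" by (rule smooth_on_subset[rotated]) simp
  moreover have "?c ` {-e<..<e} \<subseteq> twistor_space"
    using SO0_base_in_twistor[OF g] by (auto simp: A(2) conj_act_mult)
  moreover have "(?c has_vector_derivative lin_act X p) (at 0)"
  proof -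
    have d1: "((\<lambda>t. \<gamma> t *v fst p) has_vector_derivative X *v fst p) (at 0)"
      using mv.has_vector_derivative[OF d has_vector_derivative_const[of "fst p"]] by simp
    have d2: "((\<lambda>t. ladj (\<gamma> t)) has_vector_derivative - X) (at 0)"
      using bounded_linear.has_vector_derivative[OF bounded_linear_ladj d] X by simp
    have d3: "((\<lambda>t. \<gamma> t ** snd p) has_vector_derivative X ** snd p) (at 0)"
      using mm.has_vector_derivative[OF d has_vector_derivative_const[of "snd p"]] by simp
    have "((\<lambda>t. \<gamma> t ** snd p ** ladj (\<gamma> t)) has_vector_derivative X ** snd p - snd p ** X) (at 0)"
      using mm.has_vector_derivative[OF d3 d2] g0 by (simp add: bil_simps)
    with d1 show ?thesis unfolding conj_act_def lin_act_def
      by (rule has_vector_derivative_Pair)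
  qed
  ultimately have "curve_through twistor_space p (lin_act X p) ?c"
    using e g0 by (auto simp: curve_through_def conj_act_def)
  then show ?thesis by (auto simp: tangent_space_def)
qed

lemma base_in_twistor: "twistor_base \<in> twistor_space"
  using SO0_base_in_twistor[OF mat_1_SO0] by (simp add: conj_act_def)

lemma conj_lin_act:
  "A \<in> SO0 \<Longrightarrow> conj_act A (lin_act X p) = lin_act (A ** X ** ladj A) (conj_act A p)"
  by (simp add: lin_act_def conj_act_def SO0_ladj bil_simps matrix_mul_assoc[symmetric]
      matrix_vector_mul_assoc[symmetric])

lemma tangency_imp_tangent:
  assumes A: "A \<in> SO0" and K: "tangency (conj_act A twistor_base) v = 0" "ladj (snd v) = - snd v"
  obtains u B where "anticomm B" "v = conj_act A (horvert u B)"
proof -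
  note A' = SO0_ladj_in[OF A]
  have "tangency (conj_act (ladj A) (conj_act A twistor_base)) (conj_act (ladj A) v) = 0"
    using K(1) by (simp add: tangency_conj[OF A'] zero_prod_def bil_simps)
  then have "tangency twistor_base (conj_act (ladj A) v) = 0"
    by (simp add: conj_act_inverse[OF A])
  moreover have "ladj (snd (conj_act (ladj A) v)) = - snd (conj_act (ladj A) v)"
    using K(2) by (simp add: conj_act_def bil_simps matrix_mul_assoc)
  ultimately obtain u B where B: "anticomm B" "conj_act (ladj A) v = horvert u B"
    by (rule tangency_base_imp_horvert)
  then have "v = conj_act A (horvert u B)"
    using conj_act_inverse[OF A', of v] by simp
  with B(1) show ?thesis by (rule that)
qed

lemma conj_horvert_tangent:
  assumes A: "A \<in> SO0" and B: "anticomm B"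
  shows "conj_act A (horvert u B) \<in> tangent_space twistor_space (conj_act A twistor_base)"
  unfolding conj_lin_act[OF A]
  by (rule lin_act_tangent)
     (use B SO0_base_in_twistor[OF A] in \<open>simp_all add: block_so anticomm_def bil_simps matrix_mul_assoc\<close>)

lemma tangent_cases:
  assumes A: "A \<in> SO0" and v: "v \<in> tangent_space twistor_space (conj_act A twistor_base)"
  obtains u B where "anticomm B" "v = conj_act A (horvert u B)"
  using tangency_imp_tangent[OF A] tangent_imp_tangency[OF SO0_base_in_twistor[OF A] v] by blast

text \<open>No dimension count is made: tangent vectors satisfy the equations, solutions of the
  equations are transported \<open>horvert\<close> vectors, and these are velocities of curves in
  the orbit.\<close>

lemma tangent_iff:
  assumes p: "p \<in> twistor_space"
  shows "v \<in> tangent_space twistor_space p \<longleftrightarrow> tangency p v = 0 \<and> ladj (snd v) = - snd v"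
proof -
  obtain A where A: "A \<in> SO0" "p = conj_act A twistor_base" using twistor_SO0_base[OF p] .
  show ?thesis
    using tangent_imp_tangency[OF p] tangency_imp_tangent[OF A(1)] conj_horvert_tangent[OF A(1)] A(2)
    by metis
qed

section \<open>Polynomial formulas for the form and the structures\<close>

text \<open>Left multiplication by \<open>j\<close> is the complex structure on the fibre part. On
  the mixed part at the base point it yields the column \<open>u\<close> and the row
  \<open>0\<close>, where \<open>s u\<close> is wanted in both; the outer products contribute the
  column \<open>(s - 1) u\<close> and the row \<open>s u\<close>.\<close>

definition twJ :: "real \<Rightarrow> 'n::finite twistor_point \<Rightarrow> 'n twistor_point \<Rightarrow> 'n twistor_point" where
  "twJ s p v = (s *\<^sub>R (snd p *v fst v),
     snd p ** snd v + (1 - s) *\<^sub>R outer (fst v) (fst p) + s *\<^sub>R outer (fst p) (fst v))"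

text \<open>The form is \<open>\<omega>\<^sub>p(v, w) = kks_pair (kks_map p v) w\<close>. The formula is antisymmetrized so that it is
  skew for all ambient vectors and not only for tangent ones.\<close>

definition kks_map :: "'n::finite twistor_point \<Rightarrow> 'n twistor_point \<Rightarrow> 'n twistor_point" where
  "kks_map p v = (snd p *v fst v - ladj (snd p) *v fst v, snd p ** snd v - snd v ** snd p)"

definition kks_pair :: "'n::finite twistor_point \<Rightarrow> 'n twistor_point \<Rightarrow> real" where
  "kks_pair a w = - (trace (snd a ** snd w) / 4) - 3 * lorentz (fst a) (fst w) / 4"

lemma bounded_bilinear_twJ: "bounded_bilinear (twJ s)"
  by (rule bilinear_bounded) (simp_all add: twJ_def bil_simps algebra_simps)

lemma bounded_bilinear_kks_map: "bounded_bilinear kks_map"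
  by (rule bilinear_bounded) (simp_all add: kks_map_def bil_simps algebra_simps)

lemma bounded_bilinear_kks_pair: "bounded_bilinear kks_pair"
  by (rule bilinear_bounded) (simp_all add: kks_pair_def bil_simps trace_simps algebra_simps add_divide_distrib)

interpretation twJ: bounded_bilinear "twJ s" by (rule bounded_bilinear_twJ)
interpretation kmap: bounded_bilinear kks_map by (rule bounded_bilinear_kks_map)
interpretation kpair: bounded_bilinear kks_pair by (rule bounded_bilinear_kks_pair)

lemma kks_antisym: "kks_pair (kks_map p v) w = - kks_pair (kks_map p w) v"
proof -
  have "trace (snd v ** (snd p ** snd w)) = trace (snd p ** (snd w ** snd v))"
    "trace (snd w ** (snd p ** snd v)) = trace (snd p ** (snd v ** snd w))"
    by (metis matrix_mul_assoc trace_mul_sym)+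
  moreover have "lorentz (ladj (snd p) *v a) b = lorentz (snd p *v b) a" for a b
    by (metis lorentz_commute lorentz_ladj)
  ultimately show ?thesis
    by (simp add: kks_pair_def kks_map_def bil_simps trace_simps matrix_mul_assoc[symmetric] lorentz_commute
      diff_divide_distrib)
qed

lemma twJ_conj: "A \<in> SO0 \<Longrightarrow> twJ s (conj_act A p) (conj_act A v) = conj_act A (twJ s p v)"
  by (simp add: twJ_def conj_act_def SO0_ladj bil_simps matrix_mul_assoc[symmetric]
    matrix_vector_mul_assoc[symmetric] mult_outer outer_mult)

lemma trace_conj: "A \<in> SO0 \<Longrightarrow> trace (A ** (Z ** ladj A)) = trace Z"
  using trace_mul_sym[of A "Z ** ladj A"] by (simp add: matrix_mul_assoc[symmetric] SO0_ladj)

lemma kks_conj: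
  assumes "A \<in> SO0"
  shows "kks_pair (kks_map (conj_act A p) (conj_act A v)) (conj_act A w) = kks_pair (kks_map p v) w"
proof -
  have "kks_map (conj_act A p) (conj_act A v) = conj_act A (kks_map p v)"
    using assms by (simp add: kks_map_def conj_act_def SO0_ladj bil_simps matrix_mul_assoc[symmetric]
      matrix_vector_mul_assoc[symmetric])
  moreover have "kks_pair (conj_act A a) (conj_act A w) = kks_pair a w" for a
  proof -
    have "A ** snd a ** ladj A ** (A ** snd w ** ladj A) = A ** ((snd a ** snd w) ** ladj A)"
      using assms by (simp add: SO0_ladj matrix_mul_assoc[symmetric])
    then show ?thesis
      using assms trace_conj[OF assms, of "snd a ** snd w"]
      by (simp add: kks_pair_def conj_act_def SO0_lorentz)
  qed
  ultimately show ?thesis by simp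
qed

text \<open>The commutator with \<open>j\<close> squares to -4 on vertical and to -1 on horizontal
  elements of the Lie algebra. Hence the trace in \<open>kks_pair\<close>, weighted by 1/4, gives
  the whole vertical contribution but a quarter of the horizontal one, and the term weighted by 3/4
  supplies the rest. The identity is proved for all skew \<open>X\<close> and \<open>Y\<close>,
  including those in the stabilizer.\<close>

lemma kks_lin_act:
  fixes p :: "'n::finite twistor_point"
  assumes jx: "snd p *v fst p = 0" and ja: "ladj (snd p) = - snd p"
    and jj: "snd p ** snd p = - mat 1 - outer (fst p) (fst p)"
    and X: "ladj X = - X" and Y: "ladj Y = - Y"
  shows "kks_pair (kks_map p (lin_act X p)) (lin_act Y p) = - trace (snd p ** (X ** Y - Y ** X))"
proof -
  define j x Q where "j = snd p" and "x = fst p" and "Q = outer x x"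
  note a = jx[folded j_def x_def] ja[folded j_def] jj[folded j_def x_def, folded Q_def]
  have jQ: "j ** Q = 0" "Q ** j = 0" "j ** (Q ** Z) = 0" "Q ** (j ** Z) = 0" for Z :: "'n lorentz_mat"
  proof -
    show 1: "j ** Q = 0" "Q ** j = 0" by (simp_all add: Q_def mult_outer outer_mult a bil_simps)
    show "j ** (Q ** Z) = 0" "Q ** (j ** Z) = 0" by (simp_all add: matrix_mul_assoc 1 bil_simps)
  qed
  have jjZ: "j ** (j ** Z) = - Z - Q ** Z" for Z :: "'n lorentz_mat"
    by (simp add: matrix_mul_assoc a(3) bil_simps)
  \<comment> \<open>All traces that occur reduce to \<open>h\<close>, \<open>t\<close> and
    \<open>r\<close>, using cyclicity and \<open>j\<^sup>2 = - 1 - Q\<close>.\<close>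
  define h where "h = lorentz (j *v (X *v x)) (Y *v x)"
  define t where "t = trace (X ** (j ** Y))"
  define r where "r = trace (j ** (X ** Y))"
  have t7: "trace (Q ** (X ** (j ** Y))) = h"
    by (simp add: Q_def outer_mult X Y a bil_simps matrix_vector_mul_assoc[symmetric] h_def
        trace_simps lorentz_commute[of x] lorentz_so[OF Y])
  have t8: "trace (j ** (X ** (Q ** Y))) = - h"
    by (simp add: Q_def outer_mult mult_outer X Y a bil_simps h_def trace_simps
        matrix_vector_mul_assoc[symmetric])
  have t1: "trace (j ** (X ** (j ** (Y ** j)))) = - t - h"
  proof -
    have "trace (j ** (X ** (j ** (Y ** j)))) = trace (j ** (j ** (X ** (j ** Y))))"
      using trace_mul_sym[of "j ** (X ** (j ** Y))" j] by (simp add: matrix_mul_assoc)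
    then show ?thesis by (simp add: jjZ trace_simps t7 t_def)
  qed
  have t2: "trace (j ** (X ** (j ** (j ** Y)))) = - r + h"
    by (simp add: jjZ bil_simps trace_simps t8 r_def)
  have t3: "trace (X ** (Y ** j)) = r"
    using trace_mul_sym[of "X ** Y" j] by (simp add: matrix_mul_assoc r_def)
  have t4: "trace (Q ** (X ** (Y ** j))) = 0"
    using trace_mul_sym[of "Q ** (X ** Y)" j] by (simp add: matrix_mul_assoc[symmetric] jQ trace_simps)
  have t6: "trace (X ** (Q ** (Y ** j))) = - h"
    using trace_mul_sym[of "X ** (Q ** Y)" j] t8 by (simp add: matrix_mul_assoc)
  have t9: "trace (j ** (Y ** X)) = t"
    using trace_mul_sym[of X "j ** Y"] by (simp add: matrix_mul_assoc t_def)
  have "j ** (X ** j - j ** X) - (X ** j - j ** X) ** j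
      = j ** (X ** j) + j ** (X ** j) + X + X + Q ** X + X ** Q"
    by (simp add: bil_simps jjZ matrix_mul_assoc[symmetric] a(3) algebra_simps)
  note * = this
  \<comment> \<open>The summand \<open>- 6 * h\<close> is cancelled by the vector part, which enters
    as 3/4 of \<open>2 * h\<close>.\<close>
  have "trace ((j ** (X ** j - j ** X) - (X ** j - j ** X) ** j) ** (Y ** j - j ** Y)) = 4 * r - 4 * t - 6 * h"
    unfolding * unfolding mm.add_left mm.diff_right trace_simps
    by (simp add: trace_simps matrix_mul_assoc[symmetric] t1 t2 t3 t4 t6 t7 jQ t_def[symmetric] bil_simps)
  moreover have "lorentz (j *v (X *v x) - ladj j *v (X *v x)) (Y *v x) = 2 * h"
    by (simp only: a lor.diff_left mv.minus_left lor.minus_left) (simp add: h_def)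
  moreover have "trace (j ** (X ** Y - Y ** X)) = r - t"
    by (simp add: bil_simps trace_simps t9 r_def)
  ultimately show ?thesis
    by (simp add: kks_pair_def kks_map_def lin_act_def j_def[symmetric] x_def[symmetric] diff_divide_distrib)
qed

lemma anticomm_j0: "anticomm B \<Longrightarrow> anticomm (j0 ** B)"
  by (simp add: anticomm_def matrix_transpose_mul transpose_j0 bil_simps matrix_mul_assoc[symmetric])

lemma anticomm_scaleR: "anticomm B \<Longrightarrow> anticomm (c *\<^sub>R B)"
  by (simp add: anticomm_def transpose_simps bil_simps)

lemma anticommD: "anticomm B \<Longrightarrow> transpose B = - B" "anticomm B \<Longrightarrow> B ** j0 = - (j0 ** B)"
  "anticomm B \<Longrightarrow> B ** (j0 ** C) = - (j0 ** (B ** C))" "anticomm B \<Longrightarrow> B *v (j0 *v u) = - (j0 *v (B *v u))"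
  unfolding anticomm_def by (simp_all add: matrix_mul_assoc matrix_vector_mul_assoc bil_simps)

lemma twJ_base:
  assumes "anticomm B"
  shows "twJ s twistor_base (horvert u B) = horvert (s *\<^sub>R (j0 *v u)) (j0 ** B)"
  unfolding horvert_eq[OF assms] horvert_eq[OF anticomm_j0[OF assms]]
  by (simp add: twJ_def twistor_base_def axis_None j0'_block block_mult block_lvec outer_lvec
      block_arith lvec_arith dyad_simps bil_simps transpose_j0 algebra_simps)

text \<open>The polynomial is traded through \<open>kks_lin_act\<close> for the defining trace,
  which is short in block form.\<close>

lemma kks_base:
  assumes "anticomm B" "anticomm B'"
  shows "kks_pair (kks_map twistor_base (horvert u B)) (horvert u' B') =
    - 2 * ((j0 *v u) \<bullet> u') - 2 * trace (j0 ** (B ** B'))"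
proof -
  have "trace (j0 ** (B' ** B)) = - trace (j0 ** (B ** B'))"
    using trace_mul_sym[of B "j0 ** B'"] assms
    by (simp add: anticommD trace_simps matrix_mul_assoc[symmetric])
  moreover have "(j0 *v u') \<bullet> u = - ((j0 *v u) \<bullet> u')"
    by (metis inner_j0 inner_commute)
  ultimately show ?thesis
    using assms kks_lin_act[OF point_base(2-4) block_so block_so, of B B' u u']
    by (simp add: anticommD twistor_base_def j0'_block block_mult block_arith(1-4) trace_block bil_simps
        mult_dyad trace_simps)
qed

text \<open>All sign questions are settled here: the expression is symmetric, the vertical term is
  nonnegative on the diagonal because \<open>B\<close> is skew, and the horizontal term has the sign
  of \<open>- s\<close>.\<close>

lemma kks_twJ_base:
  assumes "anticomm B" "anticomm B'"
  shows "kks_pair (kks_map twistor_base (horvert u B)) (twJ s twistor_base (horvert u' B')) =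
    - 2 * s * (u \<bullet> u') - 2 * trace (B ** B')"
  unfolding twJ_base[OF assms(2)] kks_base[OF assms(1) anticomm_j0[OF assms(2)]]
  using assms(1) by (simp add: anticommD inner_j0 bil_simps)

section \<open>Agreement of the polynomial formulas with the invariant definitions\<close>

lemma SO0_tangent:
  assumes "ladj X = - X"
  shows "X \<in> tangent_space SO0 (mat 1)"
proof -
  obtain \<gamma> e where e: "e > 0" and \<gamma>: "lorentz_curve X \<gamma>"
    and g: "\<And>t. t \<in> {-e<..<e} \<Longrightarrow> \<gamma> t ** mat 1 \<in> SO0"
    using SO0_curve[OF assms mat_1_SO0] by metis
  have "smooth_on {-e<..<e} \<gamma>" 
    using \<gamma> smooth_on_subset[of "{-e<..<e}" UNIV \<gamma>] by (simp add: lorentz_curve_def)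
  then have "curve_through SO0 (mat 1) X \<gamma>"
    using e g \<gamma> by (auto simp: curve_through_def lorentz_curve_def)
  then show ?thesis by (auto simp: tangent_space_def)
qed

lemma pi1_diff_eq:
  fixes X :: "'n::finite lorentz_mat"
  assumes X: "ladj X = - X"
  shows "pi1_diff X = lin_act X twistor_base"
proof -
  let ?b = "twistor_base :: 'n twistor_point"
  have d1: "((\<lambda>A. A *v fst ?b) has_derivative (\<lambda>h. h *v fst ?b)) (at (mat 1))"
    using mv.FDERIV[OF has_derivative_ident has_derivative_const[of "fst ?b"]] by simp
  have d2: "((\<lambda>A. A ** snd ?b) has_derivative (\<lambda>h. h ** snd ?b)) (at (mat 1))"
    using mm.FDERIV[OF has_derivative_ident has_derivative_const[of "snd ?b"]] by simp
  have d3: "((\<lambda>A. A ** snd ?b ** ladj A) has_derivative (\<lambda>h. snd ?b ** ladj h + h ** snd ?b)) (at (mat 1))"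
    using mm.FDERIV[OF d2 bounded_linear_imp_has_derivative[OF bounded_linear_ladj]] by simp
  have "((\<lambda>A. conj_act A ?b) has_derivative (\<lambda>h. (h *v fst ?b, snd ?b ** ladj h + h ** snd ?b))) (at (mat 1))"
    unfolding conj_act_def by (rule has_derivative_Pair[OF d1 d3])
  then have "differential SO0 pi1 (mat 1) X = (X *v fst ?b, snd ?b ** ladj X + X ** snd ?b)"
    by (rule differential_eq[OF SO0_tangent[OF X] open_UNIV, rotated 2])
       (simp_all add: pi1_def twistor_act_SO0)
  then show ?thesis using X by (simp add: pi1_diff_def lin_act_def bil_simps)
qed

lemma twistor_push_eq:
  assumes A: "A \<in> SO0" and X: "ladj X = - X"
  shows "twistor_push A (pi1_diff X) = conj_act A (lin_act X twistor_base)"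
proof -
  have "(conj_act A has_derivative conj_act A) (at twistor_base)"
    by (rule bounded_linear_imp_has_derivative) (use linear_conj_act in \<open>simp add: linear_conv_bounded_linear\<close>)
  from differential_eq[OF lin_act_tangent[OF X base_in_twistor] open_UNIV _ _ this, of "twistor_act A"]
  show ?thesis using A by (simp add: twistor_push_def pi1_diff_eq[OF X] twistor_act_SO0)
qed

text \<open>The polynomial is invariant under the group and obeys \<open>kks_lin_act\<close> on all
  of \<open>so_lorentz\<close>, so every admissible choice of \<open>A\<close>, \<open>X\<close>,
  \<open>Y\<close> gives the same number. This makes the definite description well defined.\<close>

lemma kks_form_eq:
  assumes p: "p \<in> twistor_space"
    and v: "v \<in> tangent_space twistor_space p" and w: "w \<in> tangent_space twistor_space p"
  shows "kks_form p v w = kks_pair (kks_map p v) w"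
proof -
  have val: "- trace (j0' ** (X ** Y - Y ** X)) =
      kks_pair (kks_map (twistor_act A twistor_base) (twistor_push A (pi1_diff X))) (twistor_push A (pi1_diff Y))"
    if "A \<in> SO0" "X \<in> so_lorentz" "Y \<in> so_lorentz" for A X Y :: "'a lorentz_mat"
    using that kks_lin_act[OF point_base(2-4), of X Y]
    by (simp add: so_lorentz_iff twistor_push_eq twistor_act_SO0 kks_conj twistor_base_def)
  obtain A where A: "A \<in> SO0" "p = conj_act A twistor_base" using twistor_SO0_base[OF p] .
  obtain u B where B: "anticomm B" "v = conj_act A (horvert u B)" using tangent_cases[OF A(1)] v A(2) by metis
  obtain u' B' where B': "anticomm B'" "w = conj_act A (horvert u' B')" using tangent_cases[OF A(1)] w A(2) by metis
  have so: "ladj (block 0 u u B) = - block 0 u u B" "ladj (block 0 u' u' B') = - block 0 u' u' B'"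
    using B B' block_so by (auto simp: anticomm_def)
  have ex: "\<exists>A\<in>SO0. \<exists>X\<in>so_lorentz. \<exists>Y\<in>so_lorentz. twistor_act A twistor_base = p \<and>
      v = twistor_push A (pi1_diff X) \<and> w = twistor_push A (pi1_diff Y) \<and>
      kks_pair (kks_map p v) w = - trace (j0' ** (X ** Y - Y ** X))"
  proof (rule bexI[OF _ A(1)], rule bexI[of _ "block 0 u u B"], rule bexI[of _ "block 0 u' u' B'"])
    show "block 0 u u B \<in> so_lorentz" "block 0 u' u' B' \<in> so_lorentz"
      using so by (simp_all add: so_lorentz_iff)
    then show "twistor_act A twistor_base = p \<and>
      v = twistor_push A (pi1_diff (block 0 u u B)) \<and> w = twistor_push A (pi1_diff (block 0 u' u' B')) \<and>
      kks_pair (kks_map p v) w =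
        - trace (j0' ** (block 0 u u B ** block 0 u' u' B' - block 0 u' u' B' ** block 0 u u B))"
      using A B B' so val[OF A(1), of "block 0 u u B" "block 0 u' u' B'"]
      by (simp add: twistor_act_SO0 twistor_push_eq)
  qed
  show ?thesis unfolding kks_form_def
    by (rule the_equality, rule ex) (use val in blast)
qed

text \<open>\<open>twJ\<close> commutes with the action and has the prescribed values at the base
  point, so every choice of \<open>A\<close>, \<open>u\<close>, \<open>B\<close> leads to the same
  vector.\<close>

lemma twistor_J_eq:
  assumes p: "p \<in> twistor_space" and v: "v \<in> tangent_space twistor_space p"
  shows "twistor_J s p v = twJ s p v"
proof -
  have val: "twistor_push A (pi1_diff (block 0 (s *\<^sub>R (j0 *v u)) (s *\<^sub>R (j0 *v u)) (j0 ** B))) =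
      twJ s (twistor_act A twistor_base) (twistor_push A (pi1_diff (block 0 u u B)))"
    if "A \<in> SO0" "transpose B = - B" "B ** j0 = - (j0 ** B)" for A :: "'a lorentz_mat" and u B
  proof -
    have B: "anticomm B" using that by (simp add: anticomm_def)
    then have "transpose (j0 ** B) = - (j0 ** B)" using anticomm_j0 anticommD(1) by blast
    with that(1,2) show ?thesis
      by (simp add: twistor_push_eq block_so twistor_act_SO0 twJ_conj twJ_base[OF B])
  qed
  obtain A where A: "A \<in> SO0" "p = conj_act A twistor_base" using twistor_SO0_base[OF p] .
  obtain u B where B: "anticomm B" "v = conj_act A (horvert u B)" using tangent_cases[OF A(1)] v A(2) by metis
  have B': "transpose B = - B" "B ** j0 = - (j0 ** B)" using B(1) by (auto simp: anticomm_def)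
  have v': "v = twistor_push A (pi1_diff (block 0 u u B))" and p': "twistor_act A twistor_base = p"
    using A B(2) B' by (simp_all add: twistor_push_eq block_so twistor_act_SO0)
  show ?thesis unfolding twistor_J_def
  proof (rule the_equality)
    show "\<exists>A\<in>SO0. \<exists>u B. transpose B = - B \<and> B ** j0 = - (j0 ** B) \<and> twistor_act A twistor_base = p \<and>
        v = twistor_push A (pi1_diff (block 0 u u B)) \<and>
        twJ s p v = twistor_push A (pi1_diff (block 0 (s *\<^sub>R (j0 *v u)) (s *\<^sub>R (j0 *v u)) (j0 ** B)))"
      using A(1) B' v' p' val[OF A(1) B'] by metis
  qed (use val in blast)
qed

section \<open>Compatibility, closedness and integrability\<close>

lemma twJ_tangent:
  assumes p: "p \<in> twistor_space" and v: "v \<in> tangent_space twistor_space p" and s: "s * s = 1"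
  shows "twJ s p v \<in> tangent_space twistor_space p" "twJ s p (twJ s p v) = - v"
proof -
  obtain A where A: "A \<in> SO0" "p = conj_act A twistor_base" using twistor_SO0_base[OF p] .
  obtain u B where B: "anticomm B" "v = conj_act A (horvert u B)" using tangent_cases[OF A(1)] v A(2) by metis
  note B' = anticomm_j0[OF B(1)]
  have J: "twJ s p v = conj_act A (horvert (s *\<^sub>R (j0 *v u)) (j0 ** B))"
    using A B by (simp add: twJ_conj twJ_base)
  show "twJ s p v \<in> tangent_space twistor_space p"
    unfolding J unfolding A(2) by (rule conj_horvert_tangent[OF A(1) B'])
  have "twJ s p (twJ s p v) = conj_act A (horvert (- u) (- B))"
    unfolding J using A(1) B' s by (simp add: A(2) twJ_conj twJ_base bil_simps)
  moreover have "block 0 (- u) (- u) (- B) = - block 0 u u B"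
    by (simp add: block_arith)
  then have "horvert (- u) (- B) = - horvert u B"
    by (simp add: lin_act_def bil_simps)
  ultimately show "twJ s p (twJ s p v) = - v"
    using linear_neg[OF linear_conj_act] B(2) by metis
qed

lemma bracket_tangent:
  assumes X: "vector_field twistor_space X" and Y: "vector_field twistor_space Y"
    and p: "p \<in> (twistor_space :: 'n::finite twistor_point set)"
  shows "lie_bracket twistor_space X Y p \<in> tangent_space twistor_space p"
proof -
  have "tangency p (lie_bracket twistor_space X Y p) = 0"
    by (rule bracket_constraint[OF X Y p bounded_bilinear_tangency tangency_commute tangent_imp_tangency(1)])
  moreover have "ladj (snd (lie_bracket twistor_space X Y p)) + snd (lie_bracket twistor_space X Y p) = 0"
    by (rule bracket_linear_constraint[OF X Y p bounded_linear_antisym]) (simp add: tangent_imp_tangency(2))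
  ultimately show ?thesis using p by (simp add: tangent_iff eq_neg_iff_add_eq_0)
qed

lemma vector_field_J:
  assumes X: "vector_field (twistor_space :: 'n::finite twistor_point set) X" and s: "s * s = 1"
  shows "vector_field twistor_space (\<lambda>q. twistor_J s q (X q))"
  unfolding vector_field_def
proof
  have T: "X q \<in> tangent_space twistor_space q" if "q \<in> twistor_space" for q
    using X that by (simp add: vector_field_def)
  show "smooth_map_on twistor_space (\<lambda>q. twistor_J s q (X q))"
    unfolding smooth_map_on_def
  proof
    fix p :: "'n twistor_point" assume p: "p \<in> twistor_space"
    then obtain U g where g: "open U" "p \<in> U" "smooth_on U g" "\<forall>q\<in>twistor_space \<inter> U. g q = X q"
      using X unfolding vector_field_def smooth_map_on_def by blast
    have "smooth_on U (\<lambda>q. twJ s q (g q))"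
      by (rule smooth_on_bilinear[OF g(1) bounded_bilinear_twJ smooth_on_id[OF g(1)] g(3)])
    moreover have "\<forall>q\<in>twistor_space \<inter> U. twJ s q (g q) = twistor_J s q (X q)"
      using g(4) by (simp add: T twistor_J_eq)
    ultimately show "\<exists>U g. open U \<and> p \<in> U \<and> smooth_on U g \<and>
        (\<forall>q\<in>twistor_space \<inter> U. g q = twistor_J s q (X q))"
      using g(1,2) by blast
  qed
  show "\<forall>p\<in>twistor_space. twistor_J s p (X p) \<in> tangent_space twistor_space p"
    using T twJ_tangent(1)[OF _ _ s] twistor_J_eq by metis
qed

text \<open>These fundamental fields of the action are global and, by transitivity, realize every
  tangent vector at a given point.\<close>

lemma vector_field_lin_act:
  assumes "ladj X = - X"
  shows "vector_field twistor_space (lin_act X)"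
proof -
  have "linear (lin_act X)" by (simp add: linear_iff lin_act_def bil_simps algebra_simps)
  then have "smooth_on UNIV (lin_act X)"
    using smooth_on_linear[OF open_UNIV _ smooth_on_id[OF open_UNIV], of "lin_act X"]
    by (simp add: linear_conv_bounded_linear)
  then show ?thesis
    using assms by (auto simp: vector_field_def lin_act_tangent intro: smooth_map_on_UNIV)
qed

definition nijenhuis_form :: "real \<Rightarrow> 'n::finite twistor_point \<Rightarrow> 'n twistor_point \<Rightarrow> 'n twistor_point \<Rightarrow> 'n twistor_point" where
  "nijenhuis_form s p v w =
     twJ s (twJ s p v) w - twJ s (twJ s p w) v - twJ s p (twJ s v w - twJ s w v)"

lemma nijenhuis_eq:
  assumes X: "vector_field twistor_space X" and Y: "vector_field twistor_space Y"
    and p: "p \<in> twistor_space" and s: "s * s = 1"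
  shows "nijenhuis twistor_space (twistor_J s) X Y p = nijenhuis_form s p (X p) (Y p)"
  unfolding nijenhuis_form_def
  by (rule nijenhuis_bilinear[OF X Y p bounded_bilinear_twJ _ bracket_tangent[OF _ _ p] vector_field_J[OF _ s]])
     (simp_all add: twJ_tangent s twistor_J_eq)

text \<open>Write \<open>p = (x, j)\<close>, \<open>v = (\<xi>, k)\<close>,
  \<open>w = (\<eta>, l)\<close>. For \<open>s = 1\<close> and skew \<open>k\<close>,
  \<open>l\<close>, the associator \<open>twJ 1 (twJ 1 p v) w - twJ 1 p (twJ 1 v w)\<close> has the
  components \<open>lorentz \<xi> \<eta>\<close> times \<open>x\<close> and
  \<open>- outer x (k \<eta> + l \<xi>)\<close>. Both are symmetric in \<open>v\<close> and
  \<open>w\<close>, and the Nijenhuis form is the antisymmetrization.\<close>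

lemma nijenhuis_form_plus:
  assumes "ladj (snd v) = - snd v" "ladj (snd w) = - snd w"
  shows "nijenhuis_form 1 p v w = 0"
  using assms by (simp add: nijenhuis_form_def twJ_def bil_simps mult_outer outer_mult
    matrix_mul_assoc[symmetric] matrix_vector_mul_assoc[symmetric] lorentz_commute zero_prod_def)

lemma integrable_plus: "integrable_acs twistor_space (twistor_J 1)"
  unfolding integrable_acs_def
  by (simp add: nijenhuis_eq nijenhuis_form_plus tangent_imp_tangency(2) vector_field_def)

lemma kks_twJ:
  assumes A: "A \<in> SO0" and B: "anticomm B" "anticomm B'" and s: "s * s = 1"
  shows "assoc_form kks_form (twistor_J s) (conj_act A twistor_base) (conj_act A (horvert u B)) (conj_act A (horvert u' B'))
    = - 2 * s * (u \<bullet> u') - 2 * trace (B ** B')"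
proof -
  note t = SO0_base_in_twistor[OF A] conj_horvert_tangent[OF A B(1)] conj_horvert_tangent[OF A B(2)]
  show ?thesis
    using kks_form_eq[OF t(1,2) twJ_tangent(1)[OF t(1,3) s]]
    by (simp add: assoc_form_def twistor_J_eq[OF t(1,3)] twJ_conj[OF A] kks_conj[OF A] kks_twJ_base B)
qed

text \<open>\<open>- trace (B ** B)\<close> is the squared norm of the skew matrix \<open>B\<close>,
  so for \<open>s = - 1\<close> both terms of \<open>kks_twJ\<close> are positive multiples of
  squares. Nondegeneracy of the form rests on this too.\<close>

lemma kks_positive:
  assumes p: "p \<in> twistor_space" and v: "v \<in> tangent_space twistor_space p" and "v \<noteq> 0"
  shows "assoc_form kks_form (twistor_J (- 1)) p v v > 0"
proof -
  obtain A where A: "A \<in> SO0" "p = conj_act A twistor_base" using twistor_SO0_base[OF p] .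
  obtain u B where B: "anticomm B" "v = conj_act A (horvert u B)" using tangent_cases[OF A(1)] v A(2) by metis
  have "trace (transpose B ** B) = B \<bullet> B"
    unfolding trace_def matrix_matrix_mult_def transpose_def inner_vec_def
    by (simp, subst sum.swap, simp)
  then have tr: "trace (B ** B) = - (B \<bullet> B)"
    using anticommD(1)[OF B(1)] by (simp add: bil_simps trace_simps)
  have "u \<noteq> 0 \<or> B \<noteq> 0"
    using \<open>v \<noteq> 0\<close> B(2) linear_0[OF linear_conj_act, of A]
    by (auto simp: lin_act_def bil_simps zero_prod_def[symmetric] block_arith(5)[symmetric])
  then have "u \<bullet> u + B \<bullet> B > 0"
    using inner_gt_zero_iff[of u] inner_gt_zero_iff[of B] inner_ge_zero[of u] inner_ge_zero[of B]
    by linarith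
  then show ?thesis
    using kks_twJ[OF A(1) B(1) B(1), of "- 1" u u] tr by (simp add: A(2) B(2))
qed

text \<open>A product of three matrices anticommuting with \<open>j0\<close> again anticommutes with
  \<open>j0\<close>; conjugation by \<open>j0\<close> then reverses the sign of its trace.\<close>

lemma trace_anticomm3:
  assumes "anticomm D" "anticomm E" "anticomm F"
  shows "trace (D ** (E ** F)) = 0"
proof -
  have "D ** (E ** F) = j0 ** (D ** (E ** F) ** j0)"
    using assms by (simp add: anticommD matrix_mul_assoc[symmetric] bil_simps)
  then have "trace (D ** (E ** F)) = trace (j0 ** (D ** (E ** F) ** j0))" by simp
  also have "\<dots> = trace (D ** (E ** F) ** j0 ** j0)" by (rule trace_mul_sym)
  also have "\<dots> = - trace (D ** (E ** F))"
    by (simp add: matrix_mul_assoc[symmetric] j0_sq bil_simps trace_simps)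
  finally show ?thesis by simp
qed

text \<open>Tangent vectors at the base point in the coordinates \<open>a = - j0 u\<close>, \<open>D = - 2 j0 B\<close>, in which the
  matrix part is just \<open>block 0 a a D\<close>.\<close>

definition hv :: "'n::finite space_vec \<Rightarrow> 'n space_mat \<Rightarrow> 'n twistor_point" where
  "hv a D = (lvec 0 (j0 *v a), block 0 a a D)"

lemma horvert_hv:
  assumes "anticomm B"
  shows "horvert u B = hv (- (j0 *v u)) (- 2 *\<^sub>R (j0 ** B))"
  by (simp add: horvert_eq[OF assms] hv_def bil_simps)

lemma hv_horvert:
  assumes "anticomm D"
  shows "hv a D = horvert (j0 *v a) ((1/2) *\<^sub>R (j0 ** D))"
  using anticomm_scaleR[OF anticomm_j0[OF assms], of "1/2"]
  by (simp add: horvert_eq hv_def bil_simps)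

text \<open>A tangent vector stands in the slot of the point: this is the derivative of the form in
  the point, as left over by \<open>exterior_deriv2_trilinear\<close>.\<close>

lemma kks_hv:
  assumes "anticomm D" "anticomm E" "anticomm F"
  shows "kks_pair (kks_map (hv a D) (hv b E)) (hv c F) =
     ((D *v b) \<bullet> c - (E *v c) \<bullet> a / 2 - (F *v a) \<bullet> b / 2) - (trace (D ** (E ** F)) - trace (E ** (D ** F))) / 4"
proof -
  have sw: "(G *v x) \<bullet> y = - ((G *v y) \<bullet> x)" if "anticomm G" for G :: "'a space_mat" and x y
    using inner_transpose[of G x y] anticommD(1)[OF that] by (simp add: bil_simps inner_commute)
  have jj: "(j0 *v x) \<bullet> (j0 *v y) = x \<bullet> y" for x y :: "'a space_vec"
    by (simp add: inner_j0)
  have "kks_map (hv a D) (hv b E) = (lvec (2 * (a \<bullet> (j0 *v b))) (- 2 *\<^sub>R (j0 *v (D *v b))),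
      block 0 (D *v b - E *v a) (D *v b - E *v a) (dyad a b - dyad b a + D ** E - E ** D))"
    using assms anticommD(4)[OF assms(1)]
    by (simp add: kks_map_def hv_def block_mult block_lvec ladj_block lvec_arith(1-4) block_arith(1-4)
      anticommD(1) bil_simps inner_commute) (simp add: vec_eq_iff)
  then show ?thesis
    using assms sw[OF assms(2), of a c] sw[OF assms(3), of b a] inner_commute[of a "F *v b"] inner_commute[of b "F *v a"]
    by (simp add: kks_pair_def inner_diff_left hv_def block_mult trace_block lorentz_lvec jj trace_simps bil_simps
      dyad_mult dyad_simps anticommD(1) matrix_mul_assoc[symmetric] field_simps)
qed

text \<open>In the cyclic sum each of \<open>(D *v b) \<bullet> c\<close>,
  \<open>(E *v c) \<bullet> a\<close> and \<open>(F *v a) \<bullet> b\<close> receives the weight 1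
  - 1/2 - 1/2 = 0, and the triple traces vanish by \<open>trace_anticomm3\<close>.\<close>

lemma kks_closed:
  assumes "p \<in> twistor_space" and v: "v1 \<in> tangent_space twistor_space p"
    "v2 \<in> tangent_space twistor_space p" "v3 \<in> tangent_space twistor_space p"
  shows "kks_pair (kks_map v1 v2) v3 + kks_pair (kks_map v2 v3) v1 + kks_pair (kks_map v3 v1) v2 = 0"
proof -
  obtain A where A: "A \<in> SO0" "p = conj_act A twistor_base" using twistor_SO0_base[OF assms(1)] .
  have "\<exists>a D. anticomm D \<and> v = conj_act A (hv a D)" if "v \<in> tangent_space twistor_space p" for v
    using tangent_cases[OF A(1)] that A(2) horvert_hv anticomm_scaleR anticomm_j0 by metis
  with v obtain a b c D E F where "anticomm D" "anticomm E" "anticomm F"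
    "v1 = conj_act A (hv a D)" "v2 = conj_act A (hv b E)" "v3 = conj_act A (hv c F)" by metis
  then show ?thesis by (simp add: kks_conj[OF A(1)] kks_hv trace_anticomm3)
qed

lemma symplectic_kks: "symplectic_form (twistor_space :: 'n::finite twistor_point set) kks_form"
  unfolding symplectic_form_def
proof (intro conjI)
  let ?T = "twistor_space :: 'n twistor_point set"
  have s: "smooth_on UNIV (\<lambda>z :: 'n twistor_point \<times> 'n twistor_point \<times> 'n twistor_point. fst z)"
    "smooth_on UNIV (\<lambda>z :: 'n twistor_point \<times> 'n twistor_point \<times> 'n twistor_point. fst (snd z))"
    "smooth_on UNIV (\<lambda>z :: 'n twistor_point \<times> 'n twistor_point \<times> 'n twistor_point. snd (snd z))"
    using smooth_on_linear[OF open_UNIV bounded_linear_fst smooth_on_id[OF open_UNIV]]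
      smooth_on_linear[OF open_UNIV bounded_linear_compose[OF bounded_linear_fst bounded_linear_snd] smooth_on_id[OF open_UNIV]]
      smooth_on_linear[OF open_UNIV bounded_linear_compose[OF bounded_linear_snd bounded_linear_snd] smooth_on_id[OF open_UNIV]]
    by simp_all
  have "smooth_on UNIV (\<lambda>z :: 'n twistor_point \<times> 'n twistor_point \<times> 'n twistor_point.
      kks_pair (kks_map (fst z) (fst (snd z))) (snd (snd z)))"
    by (rule smooth_on_bilinear[OF open_UNIV bounded_bilinear_kks_pair
        smooth_on_bilinear[OF open_UNIV bounded_bilinear_kks_map s(1,2)] s(3)])
  then show "smooth_map_on {(p, v, w). p \<in> ?T \<and> v \<in> tangent_space ?T p \<and> w \<in> tangent_space ?T p}
      (\<lambda>(p, v, w). kks_form p v w)"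
    by (rule smooth_map_on_UNIV) (auto simp: kks_form_eq)
  show "\<forall>p\<in>?T. \<forall>u\<in>tangent_space ?T p. \<forall>v\<in>tangent_space ?T p. \<forall>w\<in>tangent_space ?T p. \<forall>a b.
      kks_form p (a *\<^sub>R u + b *\<^sub>R v) w = a * kks_form p u w + b * kks_form p v w"
  proof (intro ballI allI)
    fix p u v w :: "'n twistor_point" and a b
    assume p: "p \<in> ?T" and *: "u \<in> tangent_space ?T p" "v \<in> tangent_space ?T p" "w \<in> tangent_space ?T p"
    interpret tan: bounded_bilinear "tangency :: 'n twistor_point \<Rightarrow> _" by (rule bounded_bilinear_tangency)
    have "a *\<^sub>R u + b *\<^sub>R v \<in> tangent_space ?T p"
      using * p by (simp add: tangent_iff tan.add_right tan.scaleR_right)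
    then show "kks_form p (a *\<^sub>R u + b *\<^sub>R v) w = a * kks_form p u w + b * kks_form p v w"
      using p * by (simp add: kks_form_eq kmap.add_right kmap.scaleR_right kpair.add_left kpair.scaleR_left)
  qed
  show "\<forall>p\<in>?T. \<forall>v\<in>tangent_space ?T p. \<forall>w\<in>tangent_space ?T p. kks_form p v w = - kks_form p w v"
    by (metis kks_antisym kks_form_eq)
  show "\<forall>p\<in>?T. \<forall>v\<in>tangent_space ?T p. (\<forall>w\<in>tangent_space ?T p. kks_form p v w = 0) \<longrightarrow> v = 0"
  proof (intro ballI impI)
    fix p v :: "'n twistor_point"
    assume p: "p \<in> ?T" and v: "v \<in> tangent_space ?T p" and 0: "\<forall>w\<in>tangent_space ?T p. kks_form p v w = 0"
    \<comment> \<open>Nondegeneracy: a vector in the kernel is paired with its image under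
      \<open>J_minus\<close>, where positivity applies.\<close>
    have "twistor_J (- 1) p v \<in> tangent_space ?T p"
      using twJ_tangent(1)[OF p v, of "- 1"] twistor_J_eq[OF p v] by simp
    then have "assoc_form kks_form (twistor_J (- 1)) p v v = 0"
      using 0 by (simp add: assoc_form_def)
    then show "v = 0" using kks_positive[OF p v] by auto
  qed
  show "\<forall>X Y Z. vector_field ?T X \<longrightarrow> vector_field ?T Y \<longrightarrow> vector_field ?T Z \<longrightarrow>
      (\<forall>p\<in>?T. exterior_deriv2 ?T kks_form X Y Z p = 0)"
  proof (intro allI impI ballI)
    fix X Y Z and p :: "'n twistor_point"
    assume X: "vector_field ?T X" and Y: "vector_field ?T Y" and Z: "vector_field ?T Z" and p: "p \<in> ?T"
    have "X p \<in> tangent_space ?T p" "Y p \<in> tangent_space ?T p" "Z p \<in> tangent_space ?T p"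
      using X Y Z p by (auto simp: vector_field_def)
    from kks_closed[OF p this]
    show "exterior_deriv2 ?T kks_form X Y Z p = 0"
      using exterior_deriv2_trilinear[OF X Y Z p bounded_bilinear_kks_map bounded_bilinear_kks_pair
        kks_form_eq kks_antisym bracket_tangent[OF _ _ p]] by simp
  qed
qed

lemma almost_complex_J:
  assumes s: "s * s = 1"
  shows "almost_complex_structure (twistor_space :: 'n::finite twistor_point set) (twistor_J s)"
  unfolding almost_complex_structure_def
proof (intro conjI)
  let ?T = "twistor_space :: 'n twistor_point set"
  have "smooth_on UNIV (\<lambda>z :: 'n twistor_point \<times> 'n twistor_point. twJ s (fst z) (snd z))"
    by (rule smooth_on_bilinear[OF open_UNIV bounded_bilinear_twJ
          smooth_on_linear[OF open_UNIV bounded_linear_fst smooth_on_id[OF open_UNIV]]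
          smooth_on_linear[OF open_UNIV bounded_linear_snd smooth_on_id[OF open_UNIV]]])
  then show "smooth_map_on {(p, v). p \<in> ?T \<and> v \<in> tangent_space ?T p} (\<lambda>(p, v). twistor_J s p v)"
    by (rule smooth_map_on_UNIV) (auto simp: twistor_J_eq)
  show "\<forall>p\<in>?T. \<forall>v\<in>tangent_space ?T p. twistor_J s p v \<in> tangent_space ?T p"
    by (simp add: twJ_tangent(1) s twistor_J_eq)
  show "\<forall>p\<in>?T. \<forall>v\<in>tangent_space ?T p. \<forall>w\<in>tangent_space ?T p. \<forall>a b.
        twistor_J s p (a *\<^sub>R v + b *\<^sub>R w) = a *\<^sub>R twistor_J s p v + b *\<^sub>R twistor_J s p w"
  proof (intro ballI allI)
    fix p v w :: "'n twistor_point" and a b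
    assume p: "p \<in> ?T" and *: "v \<in> tangent_space ?T p" "w \<in> tangent_space ?T p"
    interpret tan: bounded_bilinear "tangency :: 'n twistor_point \<Rightarrow> _" by (rule bounded_bilinear_tangency)
    have "a *\<^sub>R v + b *\<^sub>R w \<in> tangent_space ?T p"
      using * p by (simp add: tangent_iff tan.add_right tan.scaleR_right)
    then show "twistor_J s p (a *\<^sub>R v + b *\<^sub>R w) = a *\<^sub>R twistor_J s p v + b *\<^sub>R twistor_J s p w"
      using p * by (simp add: twistor_J_eq twJ.add_right twJ.scaleR_right)
  qed
  show "\<forall>p\<in>?T. \<forall>v\<in>tangent_space ?T p. twistor_J s p (twistor_J s p v) = - v"
    by (simp add: twJ_tangent s twistor_J_eq)
qed

lemma compatible_J:
  assumes s: "s * s = 1"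
  shows "compatible_acs (twistor_space :: 'n::finite twistor_point set) kks_form (twistor_J s)"
  unfolding compatible_acs_def
proof (intro conjI ballI symplectic_kks almost_complex_J[OF s])
  fix p v w :: "'n twistor_point"
  assume p: "p \<in> twistor_space" and v: "v \<in> tangent_space twistor_space p"
    and w: "w \<in> tangent_space twistor_space p"
  obtain A where A: "A \<in> SO0" "p = conj_act A twistor_base" using twistor_SO0_base[OF p] .
  obtain u B where B: "anticomm B" "v = conj_act A (horvert u B)" using tangent_cases[OF A(1)] v A(2) by metis
  obtain u' B' where B': "anticomm B'" "w = conj_act A (horvert u' B')" using tangent_cases[OF A(1)] w A(2) by metis
  show "assoc_form kks_form (twistor_J s) p v w = assoc_form kks_form (twistor_J s) p w v"
    by (simp add: A(2) B(2) B'(2) kks_twJ[OF A(1) B(1) B'(1) s] kks_twJ[OF A(1) B'(1) B(1) s]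
        inner_commute trace_mul_sym[of B])
qed

text \<open>Horizontal vectors are witnesses: for \<open>B = 0\<close> and \<open>s = 1\<close> the
  associated form is \<open>- 2 * (u \<bullet> u)\<close>.\<close>

lemma not_positive_plus: "\<not> positive_acs (twistor_space :: 'n::finite twistor_point set) kks_form (twistor_J 1)"
proof
  assume *: "positive_acs (twistor_space :: 'n twistor_point set) kks_form (twistor_J 1)"
  define u :: "'n space_vec" where "u = axis undefined 1"
  have a: "anticomm (0 :: 'n space_mat)" by (simp add: anticomm_def transpose_simps bil_simps)
  have v: "conj_act (mat 1) (horvert u 0) \<in> tangent_space twistor_space (conj_act (mat 1) twistor_base)"
    by (rule conj_horvert_tangent[OF mat_1_SO0 a])
  have "fst (conj_act (mat 1) (horvert u 0)) = lvec 0 u"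
    by (simp add: conj_act_def horvert_eq[OF a])
  then have "conj_act (mat 1) (horvert u 0) \<noteq> 0"
    by (auto simp: u_def lvec_arith(5) axis_eq_0_iff)
  then have "assoc_form kks_form (twistor_J 1) (conj_act (mat 1) twistor_base)
      (conj_act (mat 1) (horvert u 0)) (conj_act (mat 1) (horvert u 0)) > 0"
    using * v SO0_base_in_twistor[OF mat_1_SO0] unfolding positive_acs_def by blast
  then show False
    using inner_ge_zero[of u] by (simp add: kks_twJ[OF mat_1_SO0 a a] bil_simps trace_simps)
qed

section \<open>Maximal non-integrability\<close>

lemma nijenhuis_form_conj:
  assumes "A \<in> SO0"
  shows "nijenhuis_form s (conj_act A p) (conj_act A v) (conj_act A w) = conj_act A (nijenhuis_form s p v w)"
  using assms by (simp add: nijenhuis_form_def twJ_conj linear_diff[OF linear_conj_act, symmetric])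

lemma anticomm_0: "anticomm 0"
  by (simp add: anticomm_def transpose_simps bil_simps)

lemma twJ_hv:
  assumes "anticomm D"
  shows "twJ (- 1) twistor_base (hv a D) = hv (- (j0 *v a)) (j0 ** D)"
  using assms anticomm_scaleR[OF anticomm_j0[OF assms], of "1/2"] anticomm_scaleR[OF anticomm_j0[OF anticomm_j0[OF assms]], of "1/2"]
  by (simp add: hv_horvert anticomm_j0 twJ_base bil_simps)

text \<open>The horizontal components cancel, so these values can be used to span the vertical
  directions without side effects.\<close>

lemma nijenhuis_form_horizontal:
  "nijenhuis_form (- 1) twistor_base (hv a 0) (hv c 0) =
    (0, block 0 0 0 (4 *\<^sub>R (j0 ** dyad c a - dyad c a ** j0 - (j0 ** dyad a c - dyad a c ** j0))))"
  unfolding nijenhuis_form_def twJ_hv[OF anticomm_0]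
  by (simp add: twJ_def hv_def twistor_base_def axis_None j0'_block block_mult block_lvec outer_lvec
      block_arith(1-4) lvec_arith(1-4) dyad_simps bil_simps mult_dyad dyad_mult transpose_j0 inner_j0 inner_commute)
    (simp add: vec_eq_iff all_option)

text \<open>Only the horizontal component matters, since vertical vectors are obtained separately
  and can correct the other one.\<close>

lemma nijenhuis_form_mixed:
  assumes "anticomm D"
  shows "fst (nijenhuis_form (- 1) twistor_base (hv 0 D) (hv c 0)) = lvec 0 (- 2 *\<^sub>R (D *v c))"
  unfolding nijenhuis_form_def twJ_hv[OF anticomm_0] twJ_hv[OF assms]
  using assms by (simp add: twJ_def hv_def twistor_base_def axis_None j0'_block block_mult block_lvec outer_lvec
      block_arith(1-4) lvec_arith(1-4) dyad_simps bil_simps anticommD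
      matrix_vector_mul_assoc[symmetric]) (simp add: vec_eq_iff)

lemma lin_act_surj:
  assumes p: "p \<in> twistor_space" and v: "v \<in> tangent_space twistor_space p"
  obtains X where "ladj X = - X" "lin_act X p = v"
proof -
  obtain A where A: "A \<in> SO0" "p = conj_act A twistor_base" using twistor_SO0_base[OF p] .
  obtain u B where B: "anticomm B" "v = conj_act A (horvert u B)" using tangent_cases[OF A(1)] v A(2) by metis
  have "ladj (A ** block 0 u u B ** ladj A) = - (A ** block 0 u u B ** ladj A)"
    using block_so[OF anticommD(1)[OF B(1)], of u] by (simp add: bil_simps matrix_mul_assoc)
  then show ?thesis using that conj_lin_act[OF A(1)] A(2) B(2) by metis
qed

text \<open>The tensor depends only on the values of the fields at \<open>p\<close>, and fundamental
  fields of the action realize any two tangent vectors there.\<close>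

lemma nijenhuis_values:
  assumes p: "p \<in> twistor_space" and s: "s * s = 1"
  shows "{nijenhuis twistor_space (twistor_J s) X Y p | X Y. vector_field twistor_space X \<and> vector_field twistor_space Y}
    = {nijenhuis_form s p v w | v w. v \<in> tangent_space twistor_space p \<and> w \<in> tangent_space twistor_space p}"
    (is "?L = ?R")
proof
  show "?L \<subseteq> ?R"
  proof
    fix z assume "z \<in> ?L"
    then obtain X Y where X: "vector_field twistor_space X" and Y: "vector_field twistor_space Y"
      and z: "z = nijenhuis twistor_space (twistor_J s) X Y p" by blast
    have "X p \<in> tangent_space twistor_space p" "Y p \<in> tangent_space twistor_space p"
      using X Y p by (simp_all add: vector_field_def)
    then show "z \<in> ?R" unfolding z nijenhuis_eq[OF X Y p s] by blast
  qed
  show "?R \<subseteq> ?L"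
  proof
    fix z assume "z \<in> ?R"
    then obtain v w where z: "z = nijenhuis_form s p v w" and v: "v \<in> tangent_space twistor_space p"
      and w: "w \<in> tangent_space twistor_space p" by blast
    obtain X where X: "ladj X = - X" "lin_act X p = v" using lin_act_surj[OF p v] .
    obtain Y where Y: "ladj Y = - Y" "lin_act Y p = w" using lin_act_surj[OF p w] .
    have "z = nijenhuis twistor_space (twistor_J s) (lin_act X) (lin_act Y) p"
      using nijenhuis_eq[OF vector_field_lin_act[OF X(1)] vector_field_lin_act[OF Y(1)] p s] X Y z by simp
    then show "z \<in> ?L" using vector_field_lin_act[OF X(1)] vector_field_lin_act[OF Y(1)] by blast
  qed
qed

lemma subspace_tangent:
  assumes p: "p \<in> (twistor_space :: 'n::finite twistor_point set)"
  shows "subspace (tangent_space twistor_space p)"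
proof -
  interpret tan: bounded_bilinear "tangency :: 'n twistor_point \<Rightarrow> _" by (rule bounded_bilinear_tangency)
  show ?thesis
    using p by (simp add: subspace_def tangent_iff tan.zero_right tan.add_right tan.scaleR_right)
qed

text \<open>Tangency follows without computation: the value is a Nijenhuis tensor of actual fields,
  hence a combination of brackets and their images under \<open>J\<close>.\<close>

lemma nijenhuis_form_tangent:
  assumes p: "p \<in> twistor_space" and s: "s * s = 1"
    and v: "v \<in> tangent_space twistor_space p" and w: "w \<in> tangent_space twistor_space p"
  shows "nijenhuis_form s p v w \<in> tangent_space twistor_space p"
proof -
  obtain X Y where X: "vector_field twistor_space X" and Y: "vector_field twistor_space Y"
    and n: "nijenhuis_form s p v w = nijenhuis twistor_space (twistor_J s) X Y p"
    using nijenhuis_values[OF p s] v w by blast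
  note JX = vector_field_J[OF X s] and JY = vector_field_J[OF Y s]
  have "twistor_J s p z \<in> tangent_space twistor_space p" if "z \<in> tangent_space twistor_space p" for z
    using twJ_tangent(1)[OF p that s] twistor_J_eq[OF p that] by simp
  then show ?thesis unfolding n nijenhuis_def
    using bracket_tangent[OF _ _ p] X Y JX JY by (intro subspace_diff[OF subspace_tangent[OF p]]) blast+
qed

lemma tangent_base_hv:
  "v \<in> tangent_space twistor_space twistor_base \<longleftrightarrow> (\<exists>a D. anticomm D \<and> v = hv a D)"
proof
  assume "v \<in> tangent_space twistor_space twistor_base"
  then obtain u B where "anticomm B" "v = horvert u B"
    using tangency_base_imp_horvert tangent_iff[OF base_in_twistor] by metis
  then show "\<exists>a D. anticomm D \<and> v = hv a D"
    using horvert_hv anticomm_scaleR anticomm_j0 by metis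
next
  assume "\<exists>a D. anticomm D \<and> v = hv a D"
  then obtain a D where D: "anticomm D" "v = hv a D" by blast
  then show "v \<in> tangent_space twistor_space twistor_base"
    unfolding D(2) hv_horvert[OF D(1)]
    using anticomm_scaleR[OF anticomm_j0[OF D(1)]] anticommD(1)
    by (intro lin_act_tangent block_so base_in_twistor) blast
qed

lemma matrix_dyad_expansion:
  "G = (\<Sum>i\<in>UNIV. \<Sum>k\<in>UNIV. (G $ i $ k) *\<^sub>R dyad (axis i 1) (axis k 1))" (is "G = ?R")
proof -
  have "?R $ r $ c = G $ r $ c" for r c
  proof -
    have "?R $ r $ c = (\<Sum>i\<in>UNIV. \<Sum>k\<in>UNIV. if k = c then (if i = r then G $ r $ c else 0) else 0)"
      unfolding sum_component by (intro sum.cong) (auto simp: dyad_def axis_def)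
    then show ?thesis by simp
  qed
  then show ?thesis by (simp add: vec_eq_iff)
qed

lemma vertical_in_span:
  fixes D :: "'n::finite space_mat"
  assumes D: "anticomm D"
  shows "hv 0 D \<in> span {nijenhuis_form (- 1) twistor_base v w | v w.
    v \<in> tangent_space twistor_space twistor_base \<and> w \<in> tangent_space twistor_space twistor_base}"
    (is "_ \<in> span ?S")
proof -
  \<comment> \<open>The linear extension of the value in \<open>nijenhuis_form_horizontal\<close>
    from \<open>M = dyad a c\<close> to all matrices.\<close>
  define \<Phi> :: "'n space_mat \<Rightarrow> 'n twistor_point" where
    "\<Phi> M = (0, block 0 0 0 (4 *\<^sub>R (j0 ** transpose M - transpose M ** j0 - (j0 ** M - M ** j0))))" for M
  have lin: "linear \<Phi>"
    by (simp add: linear_iff \<Phi>_def block_arith(1,4) bil_simps transpose_simps algebra_simps scaleR_add_right)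
  \<comment> \<open>\<open>G\<close> is skew and anticommutes with \<open>j0\<close>, so the spatial
    block of \<open>\<Phi> G\<close> is -8 times the commutator of \<open>j0\<close> with
    \<open>G\<close>, that is \<open>- 16 *\<^sub>R (j0 ** G)\<close>; the factor 1/16 makes this
    \<open>D\<close>.\<close>
  define G where "G = (1/16) *\<^sub>R (j0 ** D)"
  have "\<Phi> (dyad (axis i 1) (axis k 1)) \<in> ?S" for i k
  proof -
    have "\<Phi> (dyad (axis i 1) (axis k 1)) = nijenhuis_form (- 1) twistor_base (hv (axis i 1) 0) (hv (axis k 1) 0)"
      by (simp add: \<Phi>_def nijenhuis_form_horizontal)
    then show ?thesis using anticomm_0 tangent_base_hv by blast
  qed
  then have "(\<Sum>i\<in>UNIV. \<Sum>k\<in>UNIV. (G $ i $ k) *\<^sub>R \<Phi> (dyad (axis i 1) (axis k 1))) \<in> span ?S"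
    by (intro span_sum span_scale span_base)
  moreover have "(\<Sum>i\<in>UNIV. \<Sum>k\<in>UNIV. (G $ i $ k) *\<^sub>R \<Phi> (dyad (axis i 1) (axis k 1))) = \<Phi> G"
    using arg_cong[OF matrix_dyad_expansion[of G], of \<Phi>]
    by (simp add: linear_sum[OF lin] linear_cmul[OF lin])
  moreover have "\<Phi> G = hv 0 D"
    using D by (simp add: \<Phi>_def G_def hv_def lvec_arith(5)[symmetric] transpose_simps matrix_transpose_mul
      transpose_j0 bil_simps anticommD matrix_mul_assoc[symmetric])
  ultimately show ?thesis by simp
qed

lemma span_nijenhuis_form_subset:
  "span {nijenhuis_form (- 1) twistor_base v w | v w.
    v \<in> tangent_space twistor_space twistor_base \<and> w \<in> tangent_space twistor_space twistor_base}
    \<subseteq> tangent_space twistor_space twistor_base"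
proof (rule span_minimal[OF _ subspace_tangent[OF base_in_twistor]], rule subsetI, elim CollectE exE conjE)
  fix z v w :: "'n::finite twistor_point"
  assume "z = nijenhuis_form (- 1) twistor_base v w"
    "v \<in> tangent_space twistor_space twistor_base" "w \<in> tangent_space twistor_space twistor_base"
  then show "z \<in> tangent_space twistor_space twistor_base"
    using nijenhuis_form_tangent[OF base_in_twistor, of "- 1" v w] by simp
qed

lemma j0_axis: "j0 *v axis (Inl b) 1 = axis (Inr b) 1" "j0 *v axis (Inr b) 1 = - axis (Inl b) 1"
  unfolding matrix_vector_mult_basis
  by (auto simp: column_def vec_eq_iff j0_def axis_def split: sum.split)

lemma dyad_mv: "dyad u w *v x = (w \<bullet> x) *\<^sub>R u"
  by (simp add: dyad_def matrix_vector_mult_def vec_eq_iff inner_vec_def sum_distrib_left algebra_simps)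

text \<open>Mixed values have the horizontal part \<open>- 2 *\<^sub>R (D *v c)\<close>, and
  suitable \<open>D\<close>, \<open>c\<close> produce every coordinate vector. The vertical part is
  left open, because \<open>vertical_in_span\<close> can adjust it.\<close>

lemma horizontal_in_span:
  fixes a :: "'n::finite space_vec"
  assumes "CARD('n) \<ge> 2"
  shows "\<exists>D. anticomm D \<and> hv a D \<in> span {nijenhuis_form (- 1) twistor_base v w | v w.
    v \<in> tangent_space twistor_space twistor_base \<and> w \<in> tangent_space twistor_space twistor_base}"
    (is "\<exists>D. _ \<and> _ \<in> span ?S")
proof -
  note SS = span_nijenhuis_form_subset
  have two: "\<exists>b. b \<noteq> a" for a :: 'n
  proof (rule ccontr)
    assume "\<nexists>b. b \<noteq> a"
    then have "(UNIV :: 'n set) = {a}" by auto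
    from arg_cong[OF this, of card] have "CARD('n) = 1" by simp
    with assms show False by simp
  qed
  have ax: "\<exists>z\<in>?S. fst z = lvec 0 (axis i 1)" for i :: "'n + 'n"
  proof -
    \<comment> \<open>The vector \<open>e\<^sub>k\<close> has to be orthogonal to
      \<open>e\<^sub>i\<close> and to \<open>j0 e\<^sub>i\<close>, which takes a second complex
      coordinate.\<close>
    have "\<exists>k. k \<noteq> i \<and> (j0 *v axis k 1) \<bullet> axis i 1 = (0::real)"
    proof (cases i)
      case (Inl a)
      obtain b where "b \<noteq> a" using two by metis
      with Inl show ?thesis by (intro exI[of _ "Inl b"]) (simp add: j0_axis inner_axis_axis)
    next
      case (Inr a)
      obtain b where "b \<noteq> a" using two by metis
      with Inr show ?thesis by (intro exI[of _ "Inr b"]) (simp add: j0_axis inner_axis_axis)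
    qed
    then obtain k where k: "k \<noteq> i" "(j0 *v axis k 1) \<bullet> axis i 1 = (0::real)" by blast
    let ?e = "axis i 1 :: 'n space_vec" and ?f = "axis k 1 :: 'n space_vec"
    \<comment> \<open>\<open>E\<close> rotates \<open>?f\<close> to \<open>?e\<close>, and
      \<open>(1/2) *\<^sub>R (E + j0 ** E ** j0)\<close> is its part anticommuting with
      \<open>j0\<close>. The choice of \<open>k\<close> makes \<open>E\<close> kill
      \<open>j0 *v ?f\<close>, so half of \<open>?e\<close> survives; the sign and the 1/2
      compensate the factor -2 in \<open>nijenhuis_form_mixed\<close>.\<close>
    define E where "E = dyad ?e ?f - dyad ?f ?e"
    define D where "D = (- 1/2) *\<^sub>R (E + j0 ** E ** j0)"
    have D: "anticomm D"
      by (simp add: anticomm_def D_def E_def transpose_simps matrix_transpose_mul transpose_j0 bil_simps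
          matrix_mul_assoc[symmetric] j0_sq) (simp add: algebra_simps)
    have "D *v ?f = (- 1/2) *\<^sub>R ?e"
    proof -
      have "E *v ?f = ?e" "E *v (j0 *v ?f) = 0"
        using k inner_j0[of ?f ?f]
        by (simp_all add: E_def bil_simps dyad_mv inner_axis_axis inner_commute)
      then show ?thesis
        by (simp add: D_def bil_simps matrix_vector_mul_assoc[symmetric])
    qed
    then have "fst (nijenhuis_form (- 1) twistor_base (hv 0 D) (hv ?f 0)) = lvec 0 ?e"
      by (simp add: nijenhuis_form_mixed[OF D])
    then show ?thesis using tangent_base_hv D anticomm_0 by blast
  qed
  then have "\<forall>i. \<exists>z. z \<in> ?S \<and> fst z = lvec 0 (axis i 1)" unfolding Bex_def by blast
  from choice[OF this] obtain Z where Z: "\<And>i. Z i \<in> ?S" "\<And>i. fst (Z i) = lvec 0 (axis i 1)"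
    by blast
  \<comment> \<open>The horizontal component of \<open>hv a D\<close> is \<open>j0 *v a\<close>, not
    \<open>a\<close>.\<close>
  define u where "u = j0 *v a"
  define z where "z = (\<Sum>i\<in>UNIV. (u $ i) *\<^sub>R Z i)"
  have z: "z \<in> span ?S"
    unfolding z_def using Z(1) by (intro span_sum span_scale span_base)
  then obtain b D where D: "anticomm D" "z = hv b D"
    using SS tangent_base_hv by blast
  have "fst z = lvec 0 u"
    by (simp add: z_def fst_sum Z(2) vec_eq_iff all_option axis_def mult_delta_right)
  then have "j0 *v b = j0 *v a" using D(2) by (simp add: hv_def u_def)
  then have "b = a" by (metis j0_j0(2) neg_equal_iff_equal)
  then show ?thesis using D z by blast
qed

lemma nijenhuis_minus_span:
  assumes card: "CARD('n) \<ge> 2"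
  shows "span {nijenhuis_form (- 1) twistor_base v w | v w.
    v \<in> tangent_space twistor_space twistor_base \<and> w \<in> tangent_space twistor_space twistor_base}
    = tangent_space (twistor_space :: 'n::finite twistor_point set) twistor_base" (is "span ?S = ?T")
proof
  show "span ?S \<subseteq> ?T" by (rule span_nijenhuis_form_subset)
  show "?T \<subseteq> span ?S"
  proof
    fix v assume "v \<in> ?T"
    then obtain a D where D: "anticomm D" "v = hv a D" using tangent_base_hv by blast
    obtain E where E: "anticomm E" "hv a E \<in> span ?S" using horizontal_in_span[OF card] by blast
    have "anticomm (D - E)"
      using D(1) E(1) by (simp add: anticomm_def transpose_simps bil_simps)
    then have "hv a E + hv 0 (D - E) \<in> span ?S"
      using span_add[OF E(2) vertical_in_span] by blast
    moreover have "hv a E + hv 0 (D - E) = v"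
      by (simp add: D(2) hv_def lvec_arith(1) block_arith(1) bil_simps)
    ultimately show "v \<in> span ?S" by simp
  qed
qed

text \<open>Tangent space and set of values at \<open>p\<close> are the images under
  \<open>conj_act A\<close> of those at the base point, and a linear map commutes with
  \<open>span\<close>.\<close>

lemma maximally_non_integrable_minus:
  assumes card: "CARD('n) \<ge> 2"
  shows "maximally_non_integrable (twistor_space :: 'n::finite twistor_point set) (twistor_J (- 1))"
  unfolding maximally_non_integrable_def
proof
  fix p :: "'n twistor_point" assume p: "p \<in> twistor_space"
  obtain A where A: "A \<in> SO0" "p = conj_act A twistor_base" using twistor_SO0_base[OF p] .
  let ?S = "\<lambda>q. {nijenhuis_form (- 1) q v w | v w. v \<in> tangent_space twistor_space q \<and> w \<in> tangent_space twistor_space q}"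
  have T: "tangent_space twistor_space p = conj_act A ` tangent_space twistor_space twistor_base"
  proof (intro set_eqI iffI)
    fix v assume "v \<in> tangent_space twistor_space p"
    then obtain u B where B: "anticomm B" "v = conj_act A (horvert u B)"
      using tangent_cases[OF A(1)] A(2) by metis
    have "horvert u B \<in> tangent_space twistor_space twistor_base"
      by (rule lin_act_tangent[OF block_so[OF anticommD(1)[OF B(1)]] base_in_twistor])
    then show "v \<in> conj_act A ` tangent_space twistor_space twistor_base" using B(2) by blast
  next
    fix v assume "v \<in> conj_act A ` tangent_space twistor_space twistor_base"
    then obtain w where w: "w \<in> tangent_space twistor_space twistor_base" "v = conj_act A w" by blast
    then obtain a D where D: "anticomm D" "v = conj_act A (hv a D)" using tangent_base_hv[of w] by blast
    show "v \<in> tangent_space twistor_space p"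
      unfolding D(2) hv_horvert[OF D(1)] unfolding A(2)
      by (rule conj_horvert_tangent[OF A(1) anticomm_scaleR[OF anticomm_j0[OF D(1)]]])
  qed
  have "?S p = conj_act A ` ?S twistor_base"
  proof (intro set_eqI iffI)
    fix z assume "z \<in> ?S p"
    then obtain v w where "z = nijenhuis_form (- 1) p (conj_act A v) (conj_act A w)"
      "v \<in> tangent_space twistor_space twistor_base" "w \<in> tangent_space twistor_space twistor_base"
      unfolding T by blast
    then show "z \<in> conj_act A ` ?S twistor_base"
      unfolding A(2) nijenhuis_form_conj[OF A(1)] by blast
  next
    fix z assume "z \<in> conj_act A ` ?S twistor_base"
    then obtain v w where "z = nijenhuis_form (- 1) p (conj_act A v) (conj_act A w)"
      "v \<in> tangent_space twistor_space twistor_base" "w \<in> tangent_space twistor_space twistor_base"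
      unfolding A(2) nijenhuis_form_conj[OF A(1)] by blast
    then show "z \<in> ?S p" unfolding T by blast
  qed
  from trans[OF arg_cong[OF this, of span] linear_span_image[OF linear_conj_act]]
  have "span (?S p) = conj_act A ` span (?S twistor_base)" .
  then have S: "span (?S p) = tangent_space twistor_space p"
    by (simp only: nijenhuis_minus_span[OF card] T)
  have "(- 1) * (- 1) = (1::real)" by simp
  from nijenhuis_values[OF p this] S
  show "span {nijenhuis twistor_space (twistor_J (- 1)) X Y p | X Y.
      vector_field twistor_space X \<and> vector_field twistor_space Y} = tangent_space twistor_space p"
    by (simp only:)
qed

text \<open>The last claim is restricted to \<open>CARD('n) \<ge> 2\<close> because for
  \<open>n = 1\<close> every skew matrix is a multiple of \<open>j0\<close>: the fibre is discrete,
  the twistor space is the hyperbolic plane, and the Nijenhuis tensor vanishes there although the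
  tangent spaces do not.\<close>

theorem proposition6p2:
  "let T = (twistor_space :: 'n::finite twistor_point set) in
     compatible_acs T kks_form J_plus \<and> integrable_acs T J_plus \<and> \<not> positive_acs T kks_form J_plus \<and>
     positive_acs T kks_form J_minus \<and> compatible_acs T kks_form J_minus \<and>
     (CARD('n) \<ge> 2 \<longrightarrow> maximally_non_integrable T J_minus)"
proof -
  let ?T = "twistor_space :: 'n twistor_point set"
  have "compatible_acs ?T kks_form (twistor_J 1)" and c: "compatible_acs ?T kks_form (twistor_J (- 1))"
    by (simp_all add: compatible_J)
  moreover from c have "positive_acs ?T kks_form (twistor_J (- 1))"
    unfolding positive_acs_def using kks_positive by blast
  ultimately show ?thesis
    by (simp add: J_plus_def J_minus_def integrable_plus not_positive_plus maximally_non_integrable_minus)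
qed

end
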